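(* Assume that $h_0$ satisfies either Case I with $\alpha>1$, or Case II with $\alpha>3/2$. Then there exists at least one $\bar\eta>0$ with $G(\bar\eta,0)=0$ (i.e. a stationary solution of the Cauchy problem $\eta''=G(\eta,\eta')$).
   Context: Let $\Omega\subset\mathbb{R}^2$ be a bounded open set with regular boundary and $0\in\Omega$. Let $h_0\in C^1(\bar\Omega)$ with $h_0\ge 0$ and $\min_{\Omega}h_0=h_0(0)=0$. Let $F>0$, $K=\{\varphi\in H^1_0(\Omega):\varphi\ge 0\}$. For $\beta>0$, $\gamma\in\mathbb{R}$, let $q\in K$ be the unique solution of $\int_\Omega (h_0+\beta)^3\nabla q\cdot\nabla(\varphi-q)\ge \int_\Omega h_0\,\partial_{x_1}(\varphi-q)-\gamma\int_\Omega(\varphi-q)$ for all $\varphi\in K$, and set $G(\beta,\gamma)=\int_\Omega q\,dx-F$. Case I (line contact): $h_0(0,x_2)=0$ whenever $(0,x_2)\in\Omega$, $h_0(x_1,x_2)>0$ for $(x_1,x_2)\in\Omega$ with $x_1\neq0$, and there exist $\alpha\ge1$, a neighborhood $W$ of $0$ and a regular function $h_1$ on $\bar W$ with $h_1>0$ on $\bar W$ such that $h_0(x_1,x_2)=|x_1|^\alpha h_1(x_1,x_2)$ on $W$. Case II (point contact): $h_0(x)>0$ for $x\in\Omega\setminus\{0\}$, and there exist $\alpha\ge1$, a neighborhood $W$ of $0$ and a regular $h_1>0$ on $\bar W$ with $h_0(x)=|x|^\alpha h_1(x)$ on $W$ ($|\cdot|$ the Euclidean norm). *)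

theory Defs
  imports "HOL-Analysis.Analysis"
begin

type_synonym pt = "real \<times> real"

text \<open>C^1 boundary: near every boundary point, after a rotation, the open set is the
  region strictly below the graph of a C^1 function.\<close>
definition c1_boundary :: "pt set \<Rightarrow> bool" where
  "c1_boundary \<Omega> \<longleftrightarrow>
     (\<forall>p\<in>frontier \<Omega>. \<exists>r>0. \<exists>e::pt. \<exists>\<psi>::real\<Rightarrow>real.
        norm e = 1 \<and> \<psi> C1_differentiable_on UNIV \<and>
        \<Omega> \<inter> ball p r = {x\<in>ball p r. x \<bullet> e < \<psi> (x \<bullet> (- snd e, fst e))})"

definition C1_closure :: "pt set \<Rightarrow> (pt \<Rightarrow> real) \<Rightarrow> bool" where
  "C1_closure S f \<longleftrightarrow> continuous_on (closure S) f \<and>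
     (\<exists>g::pt\<Rightarrow>pt. continuous_on (closure S) g \<and>
        (\<forall>x\<in>S. (f has_derivative (\<lambda>v. g x \<bullet> v)) (at x)))"

definition test_fun :: "pt set \<Rightarrow> (pt \<Rightarrow> real) \<Rightarrow> (pt \<Rightarrow> pt) \<Rightarrow> bool" where
  "test_fun \<Omega> \<phi> d\<phi> \<longleftrightarrow> continuous_on UNIV d\<phi> \<and>
     (\<forall>x. (\<phi> has_derivative (\<lambda>v. d\<phi> x \<bullet> v)) (at x)) \<and>
     (\<exists>C. compact C \<and> C \<subseteq> \<Omega> \<and> (\<forall>x. x \<notin> C \<longrightarrow> \<phi> x = 0))"

text \<open>u \<in> H^1_0(\<Omega>) with weak gradient g: the H^1-limit (on \<Omega>) of C^1_c(\<Omega>) functions.\<close>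
definition H10 :: "pt set \<Rightarrow> (pt \<Rightarrow> real) \<Rightarrow> (pt \<Rightarrow> pt) \<Rightarrow> bool" where
  "H10 \<Omega> u g \<longleftrightarrow> u \<in> borel_measurable lebesgue \<and> g \<in> borel_measurable lebesgue \<and>
     (\<exists>\<phi> d\<phi>. (\<forall>n. test_fun \<Omega> (\<phi> n) (d\<phi> n)) \<and>
        (\<lambda>n. \<integral>\<^sup>+ x\<in>\<Omega>. ennreal ((\<phi> n x - u x)\<^sup>2) \<partial>lebesgue) \<longlonglongrightarrow> 0 \<and>
        (\<lambda>n. \<integral>\<^sup>+ x\<in>\<Omega>. ennreal ((norm (d\<phi> n x - g x))\<^sup>2) \<partial>lebesgue) \<longlonglongrightarrow> 0)"

definition inK :: "pt set \<Rightarrow> (pt \<Rightarrow> real) \<Rightarrow> (pt \<Rightarrow> pt) \<Rightarrow> bool" where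
  "inK \<Omega> u g \<longleftrightarrow> H10 \<Omega> u g \<and> (AE x in lebesgue. x \<in> \<Omega> \<longrightarrow> u x \<ge> 0)"

definition vi_solution ::
  "pt set \<Rightarrow> (pt \<Rightarrow> real) \<Rightarrow> real \<Rightarrow> real \<Rightarrow> (pt \<Rightarrow> real) \<Rightarrow> (pt \<Rightarrow> pt) \<Rightarrow> bool" where
  "vi_solution \<Omega> h0 \<beta> \<gamma> q dq \<longleftrightarrow> inK \<Omega> q dq \<and>
     (\<forall>\<phi> d\<phi>. inK \<Omega> \<phi> d\<phi> \<longrightarrow>
        (LINT x:\<Omega>|lebesgue. (h0 x + \<beta>) ^ 3 * (dq x \<bullet> (d\<phi> x - dq x)))
        \<ge> (LINT x:\<Omega>|lebesgue. h0 x * fst (d\<phi> x - dq x))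
           - \<gamma> * (LINT x:\<Omega>|lebesgue. \<phi> x - q x))"

definition G_fun :: "pt set \<Rightarrow> (pt \<Rightarrow> real) \<Rightarrow> real \<Rightarrow> real \<Rightarrow> real \<Rightarrow> real" where
  "G_fun \<Omega> h0 F \<beta> \<gamma> =
     (THE I. \<exists>q dq. vi_solution \<Omega> h0 \<beta> \<gamma> q dq \<and> I = (LINT x:\<Omega>|lebesgue. q x)) - F"

definition standing :: "pt set \<Rightarrow> (pt \<Rightarrow> real) \<Rightarrow> bool" where
  "standing \<Omega> h0 \<longleftrightarrow> bounded \<Omega> \<and> open \<Omega> \<and> c1_boundary \<Omega> \<and> (0::pt) \<in> \<Omega> \<and>
     C1_closure \<Omega> h0 \<and> (\<forall>x\<in>closure \<Omega>. h0 x \<ge> 0) \<and> h0 0 = 0"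

definition case_I :: "pt set \<Rightarrow> (pt \<Rightarrow> real) \<Rightarrow> real \<Rightarrow> bool" where
  "case_I \<Omega> h0 \<alpha> \<longleftrightarrow> \<alpha> \<ge> 1 \<and>
     (\<forall>x2. (0, x2) \<in> \<Omega> \<longrightarrow> h0 (0, x2) = 0) \<and>
     (\<forall>x\<in>\<Omega>. fst x \<noteq> 0 \<longrightarrow> h0 x > 0) \<and>
     (\<exists>W h1. open W \<and> (0::pt) \<in> W \<and> W \<subseteq> \<Omega> \<and> C1_closure W h1 \<and>
        (\<forall>x\<in>closure W. h1 x > 0) \<and>
        (\<forall>x\<in>W. h0 x = \<bar>fst x\<bar> powr \<alpha> * h1 x))"

definition case_II :: "pt set \<Rightarrow> (pt \<Rightarrow> real) \<Rightarrow> real \<Rightarrow> bool" where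
  "case_II \<Omega> h0 \<alpha> \<longleftrightarrow> \<alpha> \<ge> 1 \<and>
     (\<forall>x\<in>\<Omega> - {0}. h0 x > 0) \<and>
     (\<exists>W h1. open W \<and> (0::pt) \<in> W \<and> W \<subseteq> \<Omega> \<and> C1_closure W h1 \<and>
        (\<forall>x\<in>closure W. h1 x > 0) \<and>
        (\<forall>x\<in>W. h0 x = norm x powr \<alpha> * h1 x))"

end

theory Submission
  imports Defs
begin

text \<open>The load $Q(\beta)=\int q_\beta$ is locally Lipschitz in $\beta>0$ and at most $C/\beta^3$, so by the
  intermediate value theorem it suffices that $Q$ is unbounded as $\beta\to 0$. Adding a nonnegative test
  function $\psi$ to $q$ in the inequality gives $\int (h_0+\beta)^3\nabla q\cdot\nabla\psi \ge
  -\int \psi\,\partial_1 h_0$, and an integration by parts moves all derivatives onto $\psi$: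
  $\sup|\mathrm{div}((h_0+\beta)^3\nabla\psi)|\cdot Q(\beta) \ge -\int \psi\,\partial_1 h_0$. For a bump of width
  $\epsilon$ and height $b$ placed on the side $x_1<0$ at distance of order $\epsilon$ from the contact set, with
  $\beta=\epsilon^\alpha$, the supremum is $O(\epsilon^{3\alpha-2})$ and the right-hand side is at least
  $c\,\epsilon^{\alpha} b$, hence $Q(\beta)\ge c'\epsilon^{2-2\alpha} b$.\<close>

subsection \<open>Square integrable functions\<close>

text \<open>Of \<open>q\<close>, only the sign and the integral are usable uniformly in \<beta>: the
  gradient bound degenerates like 1/\<beta>^3. Hence all derivatives go onto the test function, and
  the sign of \<open>q\<close> turns a supremum into a multiple of the load. This differentiates
  (h_0+\<beta>)^3 only once, so h_0 in C^1 suffices and only the bump needs two derivatives. The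
  side x_1 < 0 is chosen because -d_1 h_0 is positive there near the contact set. At distance of
  order \<epsilon> it has size \<epsilon>^(\<alpha>-1), and the bump covers an area of order
  \<epsilon> b; their product is the \<epsilon>^\<alpha> b of the right-hand side. With \<beta> =
  \<epsilon>^\<alpha> the shift is comparable with h_0 on the bump: a larger \<beta> would enlarge
  the supremum, a smaller one would not improve its order. The Lipschitz constant of Q blows up as
  \<beta> tends to 0, so the intermediate value argument runs on an interval whose positive left end
  is supplied by the blow-up of the load. \<open>G_fun\<close> is a definite description, hence
  existence of a solution and uniqueness of its load come before any statement about G.\<close>

definition l2 :: "'a measure \<Rightarrow> ('a \<Rightarrow> 'b::euclidean_space) \<Rightarrow> bool" where
  "l2 M f \<longleftrightarrow> f \<in> borel_measurable M \<and> integrable M (\<lambda>x. (norm (f x))\<^sup>2)"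

text \<open>The square of the L^2 seminorm. Convergence is always expressed through this square, so
  the factor 2 of \<open>norm_add_sq_le\<close> does the work of a triangle inequality.\<close>

definition msq :: "'a measure \<Rightarrow> ('a \<Rightarrow> 'b::euclidean_space) \<Rightarrow> real" where
  "msq M f = (\<integral>x. (norm (f x))\<^sup>2 \<partial>M)"

lemma msq_nonneg [simp]: "msq M f \<ge> 0"
  by (simp add: msq_def)

lemma l2_measurable [measurable_dest]: "l2 M f \<Longrightarrow> f \<in> borel_measurable M"
  by (simp add: l2_def)

lemma l2_integrable: "l2 M f \<Longrightarrow> integrable M (\<lambda>x. (norm (f x))\<^sup>2)"
  by (simp add: l2_def)

lemma norm_add_sq_le: "(norm (a + b :: 'a::real_normed_vector))\<^sup>2 \<le> 2 * (norm a)\<^sup>2 + 2 * (norm b)\<^sup>2"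
proof -
  have "(norm (a + b))\<^sup>2 \<le> (norm a + norm b)\<^sup>2"
    by (intro power_mono norm_triangle_ineq) auto
  also have "\<dots> \<le> 2 * (norm a)\<^sup>2 + 2 * (norm b)\<^sup>2"
    using sum_squares_bound[of "norm a" "norm b"] by (simp add: power2_sum)
  finally show ?thesis .
qed

lemma norm_inner_le_sq: "2 * norm (a \<bullet> b :: real) \<le> (norm a)\<^sup>2 + (norm b)\<^sup>2"
  using Cauchy_Schwarz_ineq2[of a b] sum_squares_bound[of "norm a" "norm b"] by simp

lemma l2_add:
  assumes "l2 M f" "l2 M g"
  shows "l2 M (\<lambda>x. f x + g x)"
  unfolding l2_def
proof
  note [measurable] = l2_measurable[OF assms(1)] l2_measurable[OF assms(2)]
  show "(\<lambda>x. f x + g x) \<in> borel_measurable M" by measurable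
  show "integrable M (\<lambda>x. (norm (f x + g x))\<^sup>2)"
  proof (rule Bochner_Integration.integrable_bound)
    show "integrable M (\<lambda>x. 2 * (norm (f x))\<^sup>2 + 2 * (norm (g x))\<^sup>2)"
      using assms by (auto simp: l2_def)
  qed (auto intro!: AE_I2 simp: norm_add_sq_le)
qed

lemma l2_mult_bounded:
  assumes "l2 M f" "w \<in> borel_measurable M" "\<And>x. x \<in> space M \<Longrightarrow> \<bar>w x\<bar> \<le> (C::real)"
  shows "l2 M (\<lambda>x. w x *\<^sub>R f x)"
  unfolding l2_def
proof
  note [measurable] = l2_measurable[OF assms(1)] assms(2)
  show "(\<lambda>x. w x *\<^sub>R f x) \<in> borel_measurable M" by measurable
  show "integrable M (\<lambda>x. (norm (w x *\<^sub>R f x))\<^sup>2)"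
  proof (rule Bochner_Integration.integrable_bound)
    show "integrable M (\<lambda>x. C\<^sup>2 * (norm (f x))\<^sup>2)"
      using assms by (auto simp: l2_def)
    have "\<bar>w x\<bar>\<^sup>2 * (norm (f x))\<^sup>2 \<le> C\<^sup>2 * (norm (f x))\<^sup>2" if "x \<in> space M" for x
      by (intro mult_right_mono power_mono assms that) auto
    then show "AE x in M. norm ((norm (w x *\<^sub>R f x))\<^sup>2) \<le> norm (C\<^sup>2 * (norm (f x))\<^sup>2)"
      by (auto intro!: AE_I2 simp: power_mult_distrib)
  qed auto
qed

lemma l2_scaleR: "l2 M f \<Longrightarrow> l2 M (\<lambda>x. c *\<^sub>R f x)"
  by (rule l2_mult_bounded[where C="\<bar>c\<bar>"]) auto

lemma l2_diff: "l2 M f \<Longrightarrow> l2 M g \<Longrightarrow> l2 M (\<lambda>x. f x - g x)"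
  using l2_add[of M f "\<lambda>x. (-1) *\<^sub>R g x"] l2_scaleR[of M g "-1"] by simp

lemma (in finite_measure) l2_bounded:
  assumes "f \<in> borel_measurable M" "\<And>x. x \<in> space M \<Longrightarrow> norm (f x) \<le> C"
  shows "l2 M f"
  unfolding l2_def
proof
  show "integrable M (\<lambda>x. (norm (f x))\<^sup>2)"
    using assms by (intro integrable_const_bound[where B="C\<^sup>2"] AE_I2) (auto intro!: power_mono)
qed (use assms in auto)

lemma l2_inner:
  assumes "l2 M f" "l2 M g"
  shows "integrable M (\<lambda>x. f x \<bullet> g x)"
proof (rule Bochner_Integration.integrable_bound)
  note [measurable] = l2_measurable[OF assms(1)] l2_measurable[OF assms(2)]
  show "(\<lambda>x. f x \<bullet> g x) \<in> borel_measurable M" by measurable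
  show "integrable M (\<lambda>x. (norm (f x))\<^sup>2 + (norm (g x))\<^sup>2)"
    using assms by (auto simp: l2_def)
  show "AE x in M. norm (f x \<bullet> g x) \<le> norm ((norm (f x))\<^sup>2 + (norm (g x))\<^sup>2)"
    using norm_inner_le_sq[of "f _" "g _"] by (auto intro!: AE_I2) (smt (verit) norm_inner_le_sq real_norm_def)
qed

lemma l2_Cauchy_Schwarz:
  assumes f: "l2 M f" and g: "l2 M g"
  shows "\<bar>\<integral>x. f x \<bullet> g x \<partial>M\<bar> \<le> sqrt (msq M f) * sqrt (msq M g)"
proof -
  define a b c where "a = msq M f" and "b = msq M g" and "c = (\<integral>x. f x \<bullet> g x \<partial>M)"
  \<comment> \<open>Two parameters instead of one: the discriminant argument then needs no division
    by \<open>b\<close>.\<close>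
  have quad: "0 \<le> t\<^sup>2 * a + 2 * t * s * c + s\<^sup>2 * b" for s t
  proof -
    have "0 \<le> (\<integral>x. (norm (t *\<^sub>R f x + s *\<^sub>R g x))\<^sup>2 \<partial>M)" by simp
    also have "(\<lambda>x. (norm (t *\<^sub>R f x + s *\<^sub>R g x))\<^sup>2) =
      (\<lambda>x. t\<^sup>2 * (norm (f x))\<^sup>2 + 2 * t * s * (f x \<bullet> g x) + s\<^sup>2 * (norm (g x))\<^sup>2)"
      unfolding power2_norm_eq_inner
      by (rule ext) (simp add: inner_add_left inner_add_right inner_commute[of "g _" "f _"] power2_eq_square algebra_simps)
    also have "(\<integral>x. t\<^sup>2 * (norm (f x))\<^sup>2 + 2 * t * s * (f x \<bullet> g x) + s\<^sup>2 * (norm (g x))\<^sup>2 \<partial>M) =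
      t\<^sup>2 * a + 2 * t * s * c + s\<^sup>2 * b"
      using l2_integrable[OF f] l2_integrable[OF g] l2_inner[OF f g]
      by (simp add: a_def b_def c_def msq_def)
    finally show ?thesis .
  qed
  have ab: "a \<ge> 0" "b \<ge> 0" by (auto simp: a_def b_def)
  have "c\<^sup>2 \<le> a * b"
  proof (cases "b = 0")
    case True
    have "c = 0"
    proof (rule ccontr)
      assume "c \<noteq> 0"
      \<comment> \<open>For \<open>b = 0\<close> the form is linear in \<open>s\<close>; at
        \<open>t = 1\<close> this value of \<open>s\<close> makes it equal to -1.\<close>
      with quad[of 1 "- (a + 1) / (2 * c)"] True ab show False by (simp add: field_simps)
    qed
    with True show ?thesis by simp
  next
    case False
    with quad[of b "-c"] ab have "0 \<le> b * (a * b - c\<^sup>2)"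
      by (simp add: algebra_simps power2_eq_square)
    with False ab show ?thesis by (simp add: zero_le_mult_iff)
  qed
  then have "sqrt (c\<^sup>2) \<le> sqrt (a * b)" by (rule real_sqrt_le_mono)
  then show ?thesis by (simp only: real_sqrt_abs real_sqrt_mult a_def b_def c_def)
qed

lemma msq_add_le:
  assumes "l2 M f" "l2 M g"
  shows "msq M (\<lambda>x. f x + g x) \<le> 2 * msq M f + 2 * msq M g"
proof -
  have "msq M (\<lambda>x. f x + g x) \<le> (\<integral>x. 2 * (norm (f x))\<^sup>2 + 2 * (norm (g x))\<^sup>2 \<partial>M)"
    unfolding msq_def using assms l2_integrable[OF l2_add[OF assms]]
    by (intro integral_mono norm_add_sq_le) (auto simp: l2_def)
  also have "\<dots> = 2 * msq M f + 2 * msq M g"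
    using assms by (simp add: msq_def l2_def)
  finally show ?thesis .
qed

lemma msq_scaleR: "msq M (\<lambda>x. c *\<^sub>R f x) = c\<^sup>2 * msq M f"
  by (simp add: msq_def power_mult_distrib)

lemma msq_minus_commute: "msq M (\<lambda>x. f x - g x) = msq M (\<lambda>x. g x - f x)"
  by (simp add: msq_def norm_minus_commute)

lemma l2_inner_tendsto:
  assumes f: "\<And>n. l2 M (f n)" "l2 M f'" and g: "l2 M g"
    and lim: "(\<lambda>n. msq M (\<lambda>x. f n x - f' x)) \<longlonglongrightarrow> 0"
  shows "(\<lambda>n. \<integral>x. f n x \<bullet> g x \<partial>M) \<longlonglongrightarrow> (\<integral>x. f' x \<bullet> g x \<partial>M)"
proof -
  have "(\<lambda>n. (\<integral>x. f n x \<bullet> g x \<partial>M) - (\<integral>x. f' x \<bullet> g x \<partial>M)) \<longlonglongrightarrow> 0"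
  proof (rule Lim_null_comparison)
    show "\<forall>\<^sub>F n in sequentially. norm ((\<integral>x. f n x \<bullet> g x \<partial>M) - (\<integral>x. f' x \<bullet> g x \<partial>M))
        \<le> sqrt (msq M (\<lambda>x. f n x - f' x)) * sqrt (msq M g)"
      using l2_Cauchy_Schwarz[OF l2_diff[OF f] g] l2_inner[OF f(1) g] l2_inner[OF f(2) g]
      by (simp add: inner_diff_left)
    show "(\<lambda>n. sqrt (msq M (\<lambda>x. f n x - f' x)) * sqrt (msq M g)) \<longlonglongrightarrow> 0"
      using tendsto_mult_right[OF tendsto_real_sqrt[OF lim], of "sqrt (msq M g)"] by simp
  qed
  then show ?thesis by (simp add: LIM_zero_iff)
qed

section \<open>Completeness of L^2 along rapidly converging sequences\<close>

lemma geometric_Cauchy: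
  fixes y :: "nat \<Rightarrow> 'a::banach"
  assumes d: "\<And>k. norm (y (Suc k) - y k) \<le> R * (1/2)^k"
  shows "y \<longlonglongrightarrow> lim y" "norm (y n - lim y) \<le> 2 * R * (1/2)^n"
proof -
  have R: "R \<ge> 0" using order.trans[OF norm_ge_zero d[of 0]] by simp
  \<comment> \<open>The subtracted term is what lets the induction close: it drops by exactly
    \<open>R * (1/2)^(n+m)\<close> from \<open>m\<close> to \<open>Suc m\<close>.\<close>
  have step: "norm (y (n + m) - y n) \<le> 2 * R * (1/2)^n - 2 * R * (1/2)^(n+m)" for n m
  proof (induction m)
    case (Suc m)
    have "norm (y (n + Suc m) - y n) \<le> norm (y (Suc (n + m)) - y (n+m)) + norm (y (n + m) - y n)"
      using norm_triangle_ineq[of "y (Suc (n + m)) - y (n+m)" "y (n + m) - y n"] by simp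
    also have "\<dots> \<le> R * (1/2)^(n+m) + (2 * R * (1/2)^n - 2 * R * (1/2)^(n+m))"
      using Suc d[of "n+m"] by linarith
    finally show ?case by simp
  qed auto
  have step': "norm (y m - y n) \<le> 2 * R * (1/2)^n" if "m \<ge> n" for m n
    using step[of n "m - n"] that R by (smt (verit, ccfv_SIG) le_add_diff_inverse mult_nonneg_nonneg zero_le_power zero_le_divide_1_iff)
  have lim0: "(\<lambda>n. 2 * R * (1/2)^n) \<longlonglongrightarrow> 0"
    by (rule tendsto_mult_right_zero, rule LIMSEQ_power_zero) auto
  have "Cauchy y"
  proof (rule CauchyI')
    fix e :: real assume "e > 0"
    then have "\<forall>\<^sub>F n in sequentially. 2 * R * (1/2)^n < e"
      using order_tendstoD(2)[OF lim0] by blast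
    then obtain N where "\<And>n. n \<ge> N \<Longrightarrow> 2 * R * (1/2)^n < e" by (auto simp: eventually_sequentially)
    then have "norm (y m - y n) < e" if "m \<ge> N" "n > m" for m n
      using le_less_trans[OF step'[of m n]] that by (simp add: norm_minus_commute)
    then show "\<exists>N. \<forall>m\<ge>N. \<forall>n>m. dist (y m) (y n) < e" unfolding dist_norm by blast
  qed
  then show *: "y \<longlonglongrightarrow> lim y" by (simp add: Cauchy_convergent convergent_LIMSEQ_iff[symmetric])
  show "norm (y n - lim y) \<le> 2 * R * (1/2)^n"
  proof (rule tendsto_upperbound)
    show "(\<lambda>m. norm (y n - y m)) \<longlonglongrightarrow> norm (y n - lim y)" by (intro tendsto_intros *)
    show "\<forall>\<^sub>F m in sequentially. norm (y n - y m) \<le> 2 * R * (1/2)^n"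
      using step'[of n] by (auto simp: eventually_sequentially norm_minus_commute)
  qed auto
qed

text \<open>Weighting the squared increments by $4^k$ gives a summable majorant that controls every
  increment pointwise almost everywhere, so the tail bound needs no Minkowski inequality.\<close>

lemma l2_complete:
  fixes f :: "nat \<Rightarrow> 'a \<Rightarrow> 'b::euclidean_space"
  assumes f: "\<And>n. l2 M (f n)"
    and fast: "\<And>n. msq M (\<lambda>x. f (Suc n) x - f n x) \<le> C * (1/16)^n"
  obtains g where "l2 M g" "(\<lambda>n. msq M (\<lambda>x. f n x - g x)) \<longlonglongrightarrow> 0"
    "AE x in M. (\<lambda>n. f n x) \<longlonglongrightarrow> g x"
proof -
  note [measurable] = l2_measurable[OF f]
  define D where "D n x = f (Suc n) x - f n x" for n x
  have D: "l2 M (D n)" for n unfolding D_def by (intro l2_diff f)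
  have [measurable]: "D n \<in> borel_measurable M" for n using D by (rule l2_measurable)
  define S where "S x = (\<Sum>k. ennreal (4^k * (norm (D k x))\<^sup>2))" for x
  have [measurable]: "S \<in> borel_measurable M" unfolding S_def by measurable
  have "C \<ge> 0" using order.trans[OF msq_nonneg fast[of 0]] by simp
  have "(\<integral>\<^sup>+x. S x \<partial>M) = (\<Sum>k. \<integral>\<^sup>+x. ennreal (4^k * (norm (D k x))\<^sup>2) \<partial>M)"
    unfolding S_def by (rule nn_integral_suminf) measurable
  \<comment> \<open>The rate 1/16 in \<open>fast\<close> outweighs the factor 4^k: what remains is
    (1/4)^k, which is summable.\<close>
  also have "\<dots> \<le> (\<Sum>k. ennreal (C * (1/4)^k))"
  proof (intro suminf_le allI)
    fix k
    have "(\<integral>\<^sup>+x. ennreal (4^k * (norm (D k x))\<^sup>2) \<partial>M) = ennreal (4^k * msq M (D k))"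
      using l2_integrable[OF D[of k]]
      by (subst nn_integral_eq_integral) (auto simp: msq_def)
    also have "\<dots> \<le> ennreal (4^k * (C * (1/16)^k))"
      using fast[of k] by (intro ennreal_leI) (simp add: D_def[abs_def])
    also have "4^k * (C * (1/16)^k) = C * (1/4 :: real)^k"
      by (simp flip: power_mult_distrib)
    finally show "(\<integral>\<^sup>+x. ennreal (4^k * (norm (D k x))\<^sup>2) \<partial>M) \<le> ennreal (C * (1/4)^k)" .
  qed auto
  also have "\<dots> = ennreal (\<Sum>k. C * (1/4)^k)"
    using \<open>C \<ge> 0\<close> by (intro suminf_ennreal2 summable_mult summable_geometric) auto
  finally have fin: "(\<integral>\<^sup>+x. S x \<partial>M) < \<infinity>" by (simp add: le_less_trans[OF _ ennreal_less_top])
  then have aeS: "AE x in M. S x \<noteq> \<infinity>"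
    by (intro nn_integral_PInf_AE) auto
  define s where "s x = enn2real (S x)" for x
  have [measurable]: "s \<in> borel_measurable M" unfolding s_def by measurable
  have s_int: "integrable M s"
  proof (rule integrableI_bounded)
    have "(\<integral>\<^sup>+x. ennreal (norm (s x)) \<partial>M) \<le> (\<integral>\<^sup>+x. S x \<partial>M)"
      by (intro nn_integral_mono) (simp add: s_def, metis ennreal_enn2real_if le_cases top_greatest)
    from this fin show "(\<integral>\<^sup>+x. ennreal (norm (s x)) \<partial>M) < \<infinity>" by (rule le_less_trans)
  qed measurable
  \<comment> \<open>\<open>lim\<close> is total: where the sequence diverges its value is arbitrary,
    which happens only on a null set.\<close>
  define g where "g x = lim (\<lambda>n. f n x)" for x
  have [measurable]: "g \<in> borel_measurable M" unfolding g_def by (rule borel_measurable_lim_metric) measurable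
  have key: "(\<lambda>n. f n x) \<longlonglongrightarrow> g x \<and> (\<forall>n. (norm (f n x - g x))\<^sup>2 \<le> 4 * (1/4)^n * s x)"
    if "S x \<noteq> \<infinity>" for x
  proof -
    have s: "S x = ennreal (s x)" "s x \<ge> 0" using that by (auto simp: s_def less_top)
    have "norm (D k x) \<le> sqrt (s x) * (1/2)^k" for k
    proof -
      have "h k \<le> suminf h" for h :: "nat \<Rightarrow> ennreal"
        using sum_le_suminf[of h "{k}"] by simp
      from this[of "\<lambda>k. ennreal (4^k * (norm (D k x))\<^sup>2)"]
      have "ennreal (4^k * (norm (D k x))\<^sup>2) \<le> S x" unfolding S_def .
      then have "ennreal (4^k * (norm (D k x))\<^sup>2) \<le> ennreal (s x)" unfolding s(1) .
      then have "4^k * (norm (D k x))\<^sup>2 \<le> s x" by (rule iffD1[OF ennreal_le_iff[OF s(2)]])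
      then have "(norm (D k x))\<^sup>2 \<le> s x * (1/4)^k" by (simp add: field_simps)
      then have "sqrt ((norm (D k x))\<^sup>2) \<le> sqrt (s x * (1/4)^k)" by (rule real_sqrt_le_mono)
      also have "\<dots> = sqrt (s x) * (1/2)^k"
        by (simp add: real_sqrt_mult real_sqrt_power real_sqrt_divide)
      finally show ?thesis by simp
    qed
    then have *: "norm (f (Suc k) x - f k x) \<le> sqrt (s x) * (1/2)^k" for k by (simp add: D_def)
    note G = geometric_Cauchy[of "\<lambda>n. f n x", OF *, folded g_def]
    have "(norm (f n x - g x))\<^sup>2 \<le> 4 * (1/4)^n * s x" for n
    proof -
      have "(norm (f n x - g x))\<^sup>2 \<le> (2 * sqrt (s x) * (1/2)^n)\<^sup>2"
        by (intro power_mono G) auto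
      also have "\<dots> = 4 * ((1/2)^n * (1/2)^n) * (sqrt (s x))\<^sup>2" by (simp add: power2_eq_square)
      also have "(1/2)^n * (1/2)^n = (1/4 :: real)^n" by (simp flip: power_mult_distrib)
      finally have "(norm (f n x - g x))\<^sup>2 \<le> 4 * (1/4)^n * (sqrt (s x))\<^sup>2" .
      also have "(sqrt (s x))\<^sup>2 = s x" using s(2) by simp
      finally show ?thesis .
    qed
    with G(1) show ?thesis by blast
  qed
  have ae: "AE x in M. \<forall>n. (norm (f n x - g x))\<^sup>2 \<le> 4 * (1/4)^n * s x" using aeS key by auto
  have int: "integrable M (\<lambda>x. (norm (f n x - g x))\<^sup>2)" for n
  proof (rule Bochner_Integration.integrable_bound)
    show "integrable M (\<lambda>x. 4 * (1/4)^n * s x)" using s_int by simp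
    show "AE x in M. norm ((norm (f n x - g x))\<^sup>2) \<le> norm (4 * (1/4)^n * s x)"
      using ae by eventually_elim (use abs_ge_self order.trans in fastforce)
  qed measurable
  have fg: "l2 M (\<lambda>x. f n x - g x)" for n using int by (auto simp: l2_def)
  show thesis
  proof
    show "l2 M g" using l2_diff[OF f fg, of 0 0] by simp
    show "AE x in M. (\<lambda>n. f n x) \<longlonglongrightarrow> g x" using aeS key by auto
    show "(\<lambda>n. msq M (\<lambda>x. f n x - g x)) \<longlonglongrightarrow> 0"
    proof (rule Lim_null_comparison)
      show "\<forall>\<^sub>F n in sequentially. norm (msq M (\<lambda>x. f n x - g x)) \<le> 4 * (1/4)^n * (\<integral>x. s x \<partial>M)"
      proof (rule always_eventually, rule)
        fix n
        have "msq M (\<lambda>x. f n x - g x) \<le> (\<integral>x. 4 * (1/4)^n * s x \<partial>M)"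
          unfolding msq_def using int s_int ae by (intro integral_mono_AE) auto
        then show "norm (msq M (\<lambda>x. f n x - g x)) \<le> 4 * (1/4)^n * (\<integral>x. s x \<partial>M)" by simp
      qed
      show "(\<lambda>n. 4 * (1/4)^n * (\<integral>x. s x \<partial>M)) \<longlonglongrightarrow> 0"
        by (intro tendsto_mult_left_zero tendsto_mult_right_zero LIMSEQ_power_zero) auto
    qed
  qed
qed

subsection \<open>The space $H^1_0$\<close>

lemma test_funD:
  assumes "test_fun \<Omega> \<phi> d\<phi>"
  shows "continuous_on UNIV d\<phi>" "(\<phi> has_derivative (\<lambda>v. d\<phi> x \<bullet> v)) (at x)" "continuous_on UNIV \<phi>"
proof -
  show "continuous_on UNIV d\<phi>" using assms unfolding test_fun_def by blast
  show d: "(\<phi> has_derivative (\<lambda>v. d\<phi> x \<bullet> v)) (at x)" for x using assms unfolding test_fun_def by blast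
  show "continuous_on UNIV \<phi>"
    using has_derivative_continuous[OF d] by (simp add: continuous_at_imp_continuous_on)
qed

text \<open>\<open>test_fun\<close> restricts the support of the function only. Off the closed set
  \<open>C\<close> the function is locally zero, so uniqueness of the derivative makes the gradient
  vanish as well.\<close>

lemma test_fun_support:
  assumes "test_fun \<Omega> \<phi> d\<phi>"
  obtains C where "compact C" "C \<subseteq> \<Omega>" "\<And>x. x \<notin> C \<Longrightarrow> \<phi> x = 0" "\<And>x. x \<notin> C \<Longrightarrow> d\<phi> x = 0"
proof -
  from assms obtain C where C: "compact C" "C \<subseteq> \<Omega>" "\<And>x. x \<notin> C \<Longrightarrow> \<phi> x = 0"
    unfolding test_fun_def by blast
  have "d\<phi> x = 0" if "x \<notin> C" for x
  proof -
    have "open (- C)" using C(1) by (simp add: compact_imp_closed open_Compl)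
    then have "((\<lambda>x. 0) has_derivative (\<lambda>v. d\<phi> x \<bullet> v)) (at x)"
      by (rule has_derivative_transform_within_open[OF test_funD(2)[OF assms]]) (use that C in auto)
    then have "(\<lambda>v. d\<phi> x \<bullet> v) = (\<lambda>v. 0)"
      by (rule has_derivative_unique) auto
    then have "d\<phi> x \<bullet> d\<phi> x = 0" by metis
    then show ?thesis by simp
  qed
  with C that show thesis by blast
qed

lemma compact_support_bounded:
  fixes f :: "pt \<Rightarrow> 'b::real_normed_vector"
  assumes "compact C" "continuous_on UNIV f" "\<And>x. x \<notin> C \<Longrightarrow> f x = 0"
  obtains B where "\<And>x. norm (f x) \<le> B"
proof -
  have "compact (f ` C)" using assms by (meson compact_continuous_image continuous_on_subset top_greatest)
  then obtain B where "\<And>x. x \<in> C \<Longrightarrow> norm (f x) \<le> B"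
    by (metis bounded_iff compact_imp_bounded image_eqI)
  then have "norm (f x) \<le> max B 0" for x by (cases "x \<in> C") (auto simp: assms(3) le_max_iff_disj)
  then show thesis using that by blast
qed

text \<open>The factor \<open>Y\<close> is regular on \<Omega> only, as the profile is; the product
  is continued by zero. \<Omega> and the complement of the support form an open cover of the plane,
  and regularity is checked on each piece.\<close>

lemma test_fun_mult:
  assumes \<phi>: "test_fun \<Omega> \<phi> d\<phi>" and \<Omega>: "open \<Omega>"
    and Y: "\<And>x. x \<in> \<Omega> \<Longrightarrow> (Y has_derivative (\<lambda>v. gY x \<bullet> v)) (at x)" "continuous_on \<Omega> gY"
  shows "test_fun \<Omega> (\<lambda>x. \<phi> x * Y x) (\<lambda>x. if x \<in> \<Omega> then \<phi> x *\<^sub>R gY x + Y x *\<^sub>R d\<phi> x else 0)"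
    (is "test_fun \<Omega> ?f ?g")
proof -
  obtain C where C: "compact C" "C \<subseteq> \<Omega>" "\<And>x. x \<notin> C \<Longrightarrow> \<phi> x = 0" "\<And>x. x \<notin> C \<Longrightarrow> d\<phi> x = 0"
    by (rule test_fun_support[OF \<phi>]) blast
  have cl: "open (- C)" using C(1) by (simp add: compact_imp_closed open_Compl)
  have Ycont: "continuous_on \<Omega> Y"
    using Y(1) by (meson continuous_at_imp_continuous_on has_derivative_continuous)
  have "continuous_on \<Omega> (\<lambda>x. \<phi> x *\<^sub>R gY x + Y x *\<^sub>R d\<phi> x)"
    by (intro continuous_intros Y Ycont continuous_on_subset[OF test_funD(1)[OF \<phi>]]
        continuous_on_subset[OF test_funD(3)[OF \<phi>]]) auto
  then have 1: "continuous_on \<Omega> ?g" by (rule continuous_on_eq) auto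
  have 2: "continuous_on (- C) ?g"
    by (rule continuous_on_eq[of _ "\<lambda>x. 0"]) (use C in auto)
  have "continuous_on (\<Omega> \<union> - C) ?g" by (rule continuous_on_open_Un[OF \<Omega> cl 1 2])
  moreover have "\<Omega> \<union> - C = UNIV" using C by auto
  ultimately have cont: "continuous_on UNIV ?g" by simp
  have "(?f has_derivative (\<lambda>v. ?g x \<bullet> v)) (at x)" for x
  proof (cases "x \<in> \<Omega>")
    case True
    have "(?f has_derivative (\<lambda>v. \<phi> x * (gY x \<bullet> v) + (d\<phi> x \<bullet> v) * Y x)) (at x)"
      by (intro has_derivative_mult test_funD(2)[OF \<phi>] Y True)
    then show ?thesis using True by (simp add: inner_add_left mult.commute)
  next
    case False
    with C have "x \<in> - C" by auto
    have "(?f has_derivative (\<lambda>v. 0)) (at x)"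
      by (rule has_derivative_transform_within_open[OF has_derivative_const cl \<open>x \<in> - C\<close>])
        (use C in auto)
    with False show ?thesis by simp
  qed
  moreover have "compact C \<and> C \<subseteq> \<Omega> \<and> (\<forall>x. x \<notin> C \<longrightarrow> ?f x = 0)" using C by auto
  ultimately show ?thesis using cont unfolding test_fun_def by blast
qed

section \<open>Integration by parts without boundary terms\<close>

lemma integral_deriv_compact_support:
  fixes F f :: "real \<Rightarrow> real"
  assumes "\<And>x. (F has_field_derivative f x) (at x)" "continuous_on UNIV f"
    and R: "R \<ge> 0" "\<And>x. \<bar>x\<bar> \<ge> R \<Longrightarrow> F x = 0" "\<And>x. \<bar>x\<bar> \<ge> R \<Longrightarrow> f x = 0"
  shows "(\<integral>x. f x \<partial>lborel) = 0"
proof -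
  have "(\<integral>x. f x * indicator {-R..R} x \<partial>lborel) = F R - F (-R)"
    using assms by (intro integral_FTC_Icc_real) (auto simp: continuous_on_eq_continuous_at)
  also have "(\<lambda>x. f x * indicator {-R..R} x) = f"
    by (rule ext) (use R(3) in \<open>force simp: indicator_def\<close>)
  finally show ?thesis using R by simp
qed

text \<open>Fubini, integrating first in the differentiated variable, where the fundamental theorem
  of calculus leaves nothing. Every later integration by parts applies this to a product built with
  \<open>test_fun_mult\<close>.\<close>

lemma test_fun_integral_gradient:
  assumes "test_fun \<Omega> \<phi> d\<phi>"
  shows "(\<integral>x. fst (d\<phi> x) \<partial>lborel) = 0" "(\<integral>x. snd (d\<phi> x) \<partial>lborel) = 0"
proof -
  obtain C where C: "compact C" "\<And>x. x \<notin> C \<Longrightarrow> \<phi> x = 0" "\<And>x. x \<notin> C \<Longrightarrow> d\<phi> x = 0"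
    by (rule test_fun_support[OF assms]) blast
  obtain R where R: "R \<ge> 0" "\<And>x. x \<in> C \<Longrightarrow> norm x < R"
    using compact_imp_bounded[OF C(1)] bounded_pos_less by (metis less_eq_real_def)
  have out: "(x, y) \<notin> C" if "\<bar>x\<bar> \<ge> R \<or> \<bar>y\<bar> \<ge> R" for x y
    using R(2)[of "(x,y)"] norm_fst_le[of x y] norm_snd_le[of y x] that by fastforce
  note cont = test_funD(1)[OF assms]
  have int: "integrable lborel d\<phi>"
  proof -
    have "(\<lambda>x. indicator C x *\<^sub>R d\<phi> x) = d\<phi>" using C(3) by (auto simp: indicator_def fun_eq_iff)
    then show ?thesis
      using borel_integrable_compact[OF C(1) continuous_on_subset[OF cont]] by simp
  qed
  have d1: "((\<lambda>x. \<phi> (x, y)) has_field_derivative fst (d\<phi> (x, y))) (at x)" for x y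
  proof -
    have "((\<lambda>x. \<phi> (x, y)) has_derivative (\<lambda>v. d\<phi> (x, y) \<bullet> (v, 0))) (at x)"
      by (rule has_derivative_compose[of "\<lambda>x. (x, y)" _ _ _ \<phi>, OF _ test_funD(2)[OF assms]])
        (auto intro!: derivative_eq_intros)
    then show ?thesis
      unfolding has_field_derivative_def by (simp add: inner_prod_def)
  qed
  have d2: "((\<lambda>y. \<phi> (x, y)) has_field_derivative snd (d\<phi> (x, y))) (at y)" for x y
  proof -
    have "((\<lambda>y. \<phi> (x, y)) has_derivative (\<lambda>v. d\<phi> (x, y) \<bullet> (0, v))) (at y)"
      by (rule has_derivative_compose[of "\<lambda>y. (x, y)" _ _ _ \<phi>, OF _ test_funD(2)[OF assms]])
        (auto intro!: derivative_eq_intros)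
    then show ?thesis
      unfolding has_field_derivative_def by (simp add: inner_prod_def)
  qed
  have c1: "continuous_on UNIV (\<lambda>x. fst (d\<phi> (x, y)))" "continuous_on UNIV (\<lambda>x. snd (d\<phi> (y, x)))" for y
    by (intro continuous_intros continuous_on_compose2[OF cont]; simp)+
  have 1: "(\<integral>x. fst (d\<phi> (x, y)) \<partial>lborel) = 0" for y
    by (rule integral_deriv_compact_support[OF d1 c1(1) R(1)]) (use C out in auto)
  have 2: "(\<integral>y. snd (d\<phi> (x, y)) \<partial>lborel) = 0" for x
    by (rule integral_deriv_compact_support[OF d2 c1(2) R(1)]) (use C out in auto)
  have int': "integrable (lborel \<Otimes>\<^sub>M lborel) (\<lambda>x. fst (d\<phi> x))" "integrable (lborel \<Otimes>\<^sub>M lborel) (\<lambda>x. snd (d\<phi> x))"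
    using int unfolding lborel_prod by (auto intro: integrable_fst integrable_snd)
  have "(\<integral>x. fst (d\<phi> x) \<partial>(lborel \<Otimes>\<^sub>M lborel)) = (\<integral>y. (\<integral>x. fst (d\<phi> (x, y)) \<partial>lborel) \<partial>lborel)"
    using lborel_pair.integral_snd[of "\<lambda>x y. fst (d\<phi> (x, y))"] int'(1) by (simp add: case_prod_beta')
  then show "(\<integral>x. fst (d\<phi> x) \<partial>lborel) = 0" by (simp add: 1 lborel_prod)
  have "(\<integral>x. snd (d\<phi> x) \<partial>(lborel \<Otimes>\<^sub>M lborel)) = (\<integral>x. (\<integral>y. snd (d\<phi> (x, y)) \<partial>lborel) \<partial>lborel)"
    using lborel_pair.integral_fst'[OF int'(2)] by simp
  then show "(\<integral>x. snd (d\<phi> x) \<partial>lborel) = 0" by (simp add: 2 lborel_prod)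
qed

section \<open>Approximation by test functions on a bounded open set\<close>

locale bounded_open =
  fixes \<Omega> :: "pt set"
  assumes bounded: "bounded \<Omega>" and opn: "open \<Omega>"
begin

text \<open>The restricted measure is finite, so bounded measurable functions, constants among them,
  are square integrable.\<close>

abbreviation M where "M \<equiv> lebesgue_on \<Omega>"

lemma sets_\<Omega> [simp]: "\<Omega> \<in> sets lebesgue"
  using lmeasurable_open[OF bounded opn] by (rule fmeasurableD)

sublocale finite_measure M
  by (rule finite_measure_lebesgue_on[OF lmeasurable_open[OF bounded opn]])

lemma continuous_measurable:
  "continuous_on \<Omega> f \<Longrightarrow> f \<in> borel_measurable M"
  by (rule continuous_imp_measurable_on_sets_lebesgue) auto

lemma lebesgue_measurable_on:
  "f \<in> borel_measurable lebesgue \<Longrightarrow> f \<in> borel_measurable M"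
  by (rule measurable_restrict_space1)

lemma set_integral_M:
  fixes f :: "pt \<Rightarrow> real"
  shows "(LINT x:\<Omega>|lebesgue. f x) = (\<integral>x. f x \<partial>M)"
  by (simp add: set_lebesgue_integral_def integral_restrict_space)

lemma set_nn_integral_M: "(\<integral>\<^sup>+x\<in>\<Omega>. f x \<partial>lebesgue) = (\<integral>\<^sup>+x. f x \<partial>M)"
  by (simp add: nn_integral_restrict_space)

lemma AE_M: "(AE x in lebesgue. x \<in> \<Omega> \<longrightarrow> P x) \<longleftrightarrow> (AE x in M. P x)"
  by (simp add: AE_restrict_space_iff)

lemma l2_test_fun:
  assumes "test_fun \<Omega> \<phi> d\<phi>"
  shows "l2 M \<phi>" "l2 M d\<phi>"
proof -
  obtain C where C: "compact C" "\<And>x. x \<notin> C \<Longrightarrow> \<phi> x = 0" "\<And>x. x \<notin> C \<Longrightarrow> d\<phi> x = 0"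
    by (rule test_fun_support[OF assms]) blast
  obtain B1 B2 where "\<And>x. norm (\<phi> x) \<le> B1" "\<And>x. norm (d\<phi> x) \<le> B2"
    using compact_support_bounded[OF C(1) test_funD(3)[OF assms] C(2)]
      compact_support_bounded[OF C(1) test_funD(1)[OF assms] C(3)] by metis
  then show "l2 M \<phi>" "l2 M d\<phi>"
    using test_funD[OF assms]
    by (auto intro!: l2_bounded continuous_measurable intro: continuous_on_subset)
qed

lemma integral_test_gradient:
  assumes "test_fun \<Omega> \<phi> d\<phi>"
  shows "(\<integral>x. fst (d\<phi> x) \<partial>M) = 0" "(\<integral>x. snd (d\<phi> x) \<partial>M) = 0"
proof -
  obtain C where C: "C \<subseteq> \<Omega>" "\<And>x. x \<notin> C \<Longrightarrow> d\<phi> x = 0"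
    by (rule test_fun_support[OF assms]) blast
  have "(\<lambda>x. indicator \<Omega> x *\<^sub>R fst (d\<phi> x)) = (\<lambda>x. fst (d\<phi> x))"
    "(\<lambda>x. indicator \<Omega> x *\<^sub>R snd (d\<phi> x)) = (\<lambda>x. snd (d\<phi> x))"
    using C by (fastforce simp: indicator_def fun_eq_iff simp del: split_paired_All)+
  moreover have "(\<lambda>x. fst (d\<phi> x)) \<in> borel_measurable lborel" "(\<lambda>x. snd (d\<phi> x)) \<in> borel_measurable lborel"
    using test_funD(1)[OF assms] by (auto intro!: borel_measurable_continuous_onI continuous_intros)
  ultimately show "(\<integral>x. fst (d\<phi> x) \<partial>M) = 0" "(\<integral>x. snd (d\<phi> x) \<partial>M) = 0"
    using test_fun_integral_gradient[OF assms]
    by (simp_all add: integral_restrict_space integral_completion)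
qed

lemma nn_integral_l2:
  "l2 M f \<Longrightarrow> (\<integral>\<^sup>+x. ennreal ((norm (f x))\<^sup>2) \<partial>M) = ennreal (msq M f)"
  unfolding msq_def by (rule nn_integral_eq_integral) (auto simp: l2_def)

lemma nn_integral_finite_l2:
  assumes "f \<in> borel_measurable M" "(\<integral>\<^sup>+x. ennreal ((norm (f x))\<^sup>2) \<partial>M) < \<infinity>"
  shows "l2 M f"
  unfolding l2_def using assms by (auto intro!: integrableI_bounded)

text \<open>\<open>H10\<close> is phrased with extended integrals and does not assert that
  \<open>u\<close> is square integrable. Convergence to 0 makes one distance finite, and then
  \<open>u\<close> is a difference of two square integrable functions.\<close>

lemma l2_limit_of_nn_integral:
  assumes \<phi>: "\<And>n. l2 M (\<phi> n)" and u: "u \<in> borel_measurable M"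
    and lim: "(\<lambda>n. \<integral>\<^sup>+x. ennreal ((norm (\<phi> n x - u x))\<^sup>2) \<partial>M) \<longlonglongrightarrow> 0"
  shows "l2 M u" "(\<lambda>n. msq M (\<lambda>x. \<phi> n x - u x)) \<longlonglongrightarrow> 0"
proof -
  have "\<forall>\<^sub>F n in sequentially. (\<integral>\<^sup>+x. ennreal ((norm (\<phi> n x - u x))\<^sup>2) \<partial>M) < \<infinity>"
    by (rule order_tendstoD(2)[OF lim]) simp
  then obtain n where n: "(\<integral>\<^sup>+x. ennreal ((norm (\<phi> n x - u x))\<^sup>2) \<partial>M) < \<infinity>"
    by (auto simp: eventually_sequentially)
  have "l2 M (\<lambda>x. \<phi> n x - u x)"
    using u l2_measurable[OF \<phi>[of n]] by (intro nn_integral_finite_l2 n) measurable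
  from l2_diff[OF \<phi>[of n] this] show "l2 M u" by simp
  then have "l2 M (\<lambda>x. \<phi> n x - u x)" for n using \<phi> by (intro l2_diff)
  from nn_integral_l2[OF this] lim show "(\<lambda>n. msq M (\<lambda>x. \<phi> n x - u x)) \<longlonglongrightarrow> 0"
    by (simp add: ennreal_tendsto_0_iff)
qed

lemma H10D:
  assumes "H10 \<Omega> u g"
  shows "l2 M u" "l2 M g"
    "\<exists>\<phi> d\<phi>. (\<forall>n. test_fun \<Omega> (\<phi> n) (d\<phi> n)) \<and> (\<lambda>n. msq M (\<lambda>x. \<phi> n x - u x)) \<longlonglongrightarrow> 0 \<and>
       (\<lambda>n. msq M (\<lambda>x. d\<phi> n x - g x)) \<longlonglongrightarrow> 0"
proof -
  from assms obtain \<phi> d\<phi> where *: "u \<in> borel_measurable lebesgue" "g \<in> borel_measurable lebesgue"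
    "\<And>n. test_fun \<Omega> (\<phi> n) (d\<phi> n)"
    "(\<lambda>n. \<integral>\<^sup>+ x. ennreal ((norm (\<phi> n x - u x))\<^sup>2) \<partial>M) \<longlonglongrightarrow> 0"
    "(\<lambda>n. \<integral>\<^sup>+ x. ennreal ((norm (d\<phi> n x - g x))\<^sup>2) \<partial>M) \<longlonglongrightarrow> 0"
    unfolding H10_def set_nn_integral_M by auto
  note a = l2_limit_of_nn_integral[OF l2_test_fun(1)[OF *(3)] lebesgue_measurable_on[OF *(1)] *(4)]
  note b = l2_limit_of_nn_integral[OF l2_test_fun(2)[OF *(3)] lebesgue_measurable_on[OF *(2)] *(5)]
  from a b *(3) show "l2 M u" "l2 M g" "\<exists>\<phi> d\<phi>. (\<forall>n. test_fun \<Omega> (\<phi> n) (d\<phi> n)) \<and> (\<lambda>n. msq M (\<lambda>x. \<phi> n x - u x)) \<longlonglongrightarrow> 0 \<and>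
       (\<lambda>n. msq M (\<lambda>x. d\<phi> n x - g x)) \<longlonglongrightarrow> 0" by blast+
qed

lemma H10I:
  assumes m: "u \<in> borel_measurable lebesgue" "g \<in> borel_measurable lebesgue" and l: "l2 M u" "l2 M g"
    and t: "\<And>n. test_fun \<Omega> (\<phi> n) (d\<phi> n)"
    and lim: "(\<lambda>n. msq M (\<lambda>x. \<phi> n x - u x)) \<longlonglongrightarrow> 0" "(\<lambda>n. msq M (\<lambda>x. d\<phi> n x - g x)) \<longlonglongrightarrow> 0"
  shows "H10 \<Omega> u g"
proof -
  have "(\<lambda>n. \<integral>\<^sup>+ x. ennreal ((norm (\<phi> n x - u x))\<^sup>2) \<partial>M) \<longlonglongrightarrow> 0"
    using lim(1) by (subst nn_integral_l2) (auto simp: ennreal_tendsto_0_iff intro!: l2_diff l l2_test_fun(1)[OF t])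
  moreover have "(\<lambda>n. \<integral>\<^sup>+ x. ennreal ((norm (d\<phi> n x - g x))\<^sup>2) \<partial>M) \<longlonglongrightarrow> 0"
    using lim(2) by (subst nn_integral_l2) (auto simp: ennreal_tendsto_0_iff intro!: l2_diff l l2_test_fun(2)[OF t])
  ultimately show ?thesis
    unfolding H10_def set_nn_integral_M using m t by auto
qed

lemma H10_measurable:
  "H10 \<Omega> u g \<Longrightarrow> u \<in> borel_measurable lebesgue" "H10 \<Omega> u g \<Longrightarrow> g \<in> borel_measurable lebesgue"
  by (auto simp: H10_def)

lemma H10_test:
  assumes "test_fun \<Omega> \<phi> d\<phi>"
  shows "H10 \<Omega> \<phi> d\<phi>"
proof (rule H10I[where \<phi>="\<lambda>n. \<phi>" and d\<phi>="\<lambda>n. d\<phi>"])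
  have "\<phi> \<in> borel_measurable borel" "d\<phi> \<in> borel_measurable borel"
    using test_funD[OF assms] by (auto intro!: borel_measurable_continuous_onI)
  then show "\<phi> \<in> borel_measurable lebesgue" "d\<phi> \<in> borel_measurable lebesgue"
    by (auto intro!: measurable_completion)
qed (use assms l2_test_fun in \<open>auto simp: msq_def\<close>)

lemma test_fun_lincomb:
  assumes "test_fun \<Omega> \<phi> d\<phi>" "test_fun \<Omega> \<psi> d\<psi>"
  shows "test_fun \<Omega> (\<lambda>x. a * \<phi> x + b * \<psi> x) (\<lambda>x. a *\<^sub>R d\<phi> x + b *\<^sub>R d\<psi> x)"
proof -
  obtain C where C: "compact C" "C \<subseteq> \<Omega>" "\<And>x. x \<notin> C \<Longrightarrow> \<phi> x = 0"
    by (rule test_fun_support[OF assms(1)]) blast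
  obtain D where D: "compact D" "D \<subseteq> \<Omega>" "\<And>x. x \<notin> D \<Longrightarrow> \<psi> x = 0"
    by (rule test_fun_support[OF assms(2)]) blast
  have "compact (C \<union> D) \<and> C \<union> D \<subseteq> \<Omega> \<and> (\<forall>x. x \<notin> C \<union> D \<longrightarrow> a * \<phi> x + b * \<psi> x = 0)"
    using C D by auto
  moreover have "continuous_on UNIV (\<lambda>x. a *\<^sub>R d\<phi> x + b *\<^sub>R d\<psi> x)"
    by (intro continuous_intros test_funD(1)[OF assms(1)] test_funD(1)[OF assms(2)])
  moreover have "((\<lambda>x. a * \<phi> x + b * \<psi> x) has_derivative (\<lambda>v. (a *\<^sub>R d\<phi> x + b *\<^sub>R d\<psi> x) \<bullet> v)) (at x)" for x
    by (auto intro!: derivative_eq_intros test_funD(2)[OF assms(1)] test_funD(2)[OF assms(2)] simp: inner_add_left)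
  ultimately show ?thesis unfolding test_fun_def by blast
qed

lemma msq_lincomb_tendsto:
  assumes "\<And>n. l2 M (\<phi> n)" "l2 M u" "(\<lambda>n. msq M (\<lambda>x. \<phi> n x - u x)) \<longlonglongrightarrow> 0"
    and "\<And>n. l2 M (\<psi> n)" "l2 M v" "(\<lambda>n. msq M (\<lambda>x. \<psi> n x - v x)) \<longlonglongrightarrow> 0"
  shows "(\<lambda>n. msq M (\<lambda>x. (a *\<^sub>R \<phi> n x + b *\<^sub>R \<psi> n x) - (a *\<^sub>R u x + b *\<^sub>R v x))) \<longlonglongrightarrow> 0"
proof (rule Lim_null_comparison[OF always_eventually])
  show "(\<lambda>n. 2 * (a\<^sup>2 * msq M (\<lambda>x. \<phi> n x - u x)) + 2 * (b\<^sup>2 * msq M (\<lambda>x. \<psi> n x - v x))) \<longlonglongrightarrow> 0"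
    using assms(3,6) by (auto intro!: tendsto_eq_intros)
  show "\<forall>n. norm (msq M (\<lambda>x. (a *\<^sub>R \<phi> n x + b *\<^sub>R \<psi> n x) - (a *\<^sub>R u x + b *\<^sub>R v x)))
     \<le> 2 * (a\<^sup>2 * msq M (\<lambda>x. \<phi> n x - u x)) + 2 * (b\<^sup>2 * msq M (\<lambda>x. \<psi> n x - v x))"
  proof
    fix n
    have "(\<lambda>x. (a *\<^sub>R \<phi> n x + b *\<^sub>R \<psi> n x) - (a *\<^sub>R u x + b *\<^sub>R v x))
      = (\<lambda>x. a *\<^sub>R (\<phi> n x - u x) + b *\<^sub>R (\<psi> n x - v x))" by (simp add: algebra_simps)
    then show "norm (msq M (\<lambda>x. (a *\<^sub>R \<phi> n x + b *\<^sub>R \<psi> n x) - (a *\<^sub>R u x + b *\<^sub>R v x)))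
     \<le> 2 * (a\<^sup>2 * msq M (\<lambda>x. \<phi> n x - u x)) + 2 * (b\<^sup>2 * msq M (\<lambda>x. \<psi> n x - v x))"
      using msq_add_le[OF l2_scaleR[OF l2_diff[OF assms(1)[of n] assms(2)], of a]
          l2_scaleR[OF l2_diff[OF assms(4)[of n] assms(5)], of b]]
      by (simp add: msq_scaleR)
  qed
qed

lemma H10_lincomb:
  assumes "H10 \<Omega> u g" "H10 \<Omega> v h"
  shows "H10 \<Omega> (\<lambda>x. a * u x + b * v x) (\<lambda>x. a *\<^sub>R g x + b *\<^sub>R h x)"
proof -
  obtain \<phi> d\<phi> where \<phi>: "\<And>n. test_fun \<Omega> (\<phi> n) (d\<phi> n)" "(\<lambda>n. msq M (\<lambda>x. \<phi> n x - u x)) \<longlonglongrightarrow> 0"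
       "(\<lambda>n. msq M (\<lambda>x. d\<phi> n x - g x)) \<longlonglongrightarrow> 0" using H10D(3)[OF assms(1)] by blast
  obtain \<psi> d\<psi> where \<psi>: "\<And>n. test_fun \<Omega> (\<psi> n) (d\<psi> n)" "(\<lambda>n. msq M (\<lambda>x. \<psi> n x - v x)) \<longlonglongrightarrow> 0"
       "(\<lambda>n. msq M (\<lambda>x. d\<psi> n x - h x)) \<longlonglongrightarrow> 0" using H10D(3)[OF assms(2)] by blast
  note [measurable] = H10_measurable[OF assms(1)] H10_measurable[OF assms(2)]
  note l = H10D(1,2)[OF assms(1)] H10D(1,2)[OF assms(2)]
  show ?thesis
  proof (rule H10I)
    show "test_fun \<Omega> (\<lambda>x. a * \<phi> n x + b * \<psi> n x) (\<lambda>x. a *\<^sub>R d\<phi> n x + b *\<^sub>R d\<psi> n x)" for n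
      by (rule test_fun_lincomb[OF \<phi>(1) \<psi>(1)])
    show "(\<lambda>n. msq M (\<lambda>x. a * \<phi> n x + b * \<psi> n x - (a * u x + b * v x))) \<longlonglongrightarrow> 0"
      using msq_lincomb_tendsto[OF l2_test_fun(1)[OF \<phi>(1)] l(1) \<phi>(2) l2_test_fun(1)[OF \<psi>(1)] l(3) \<psi>(2)] by simp
    show "(\<lambda>n. msq M (\<lambda>x. a *\<^sub>R d\<phi> n x + b *\<^sub>R d\<psi> n x - (a *\<^sub>R g x + b *\<^sub>R h x))) \<longlonglongrightarrow> 0"
      using msq_lincomb_tendsto[OF l2_test_fun(2)[OF \<phi>(1)] l(2) \<phi>(3) l2_test_fun(2)[OF \<psi>(1)] l(4) \<psi>(3)] by simp
    show "l2 M (\<lambda>x. a * u x + b * v x)"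
      using l2_add[OF l2_scaleR[OF l(1), of a] l2_scaleR[OF l(3), of b]] by simp
    show "l2 M (\<lambda>x. a *\<^sub>R g x + b *\<^sub>R h x)"
      by (intro l2_add l2_scaleR l)
  qed measurable
qed

text \<open>The indicator makes the limits measurable on the whole plane, as the definition of $H^1_0$
  demands; the $L^2$ limits are only known to be measurable on the domain.\<close>

lemma H10_closed:
  assumes H: "\<And>n. H10 \<Omega> (u n) (g n)" and l: "l2 M v" "l2 M h"
    and lim: "(\<lambda>n. msq M (\<lambda>x. u n x - v x)) \<longlonglongrightarrow> 0" "(\<lambda>n. msq M (\<lambda>x. g n x - h x)) \<longlonglongrightarrow> 0"
  shows "H10 \<Omega> (\<lambda>x. indicator \<Omega> x *\<^sub>R v x) (\<lambda>x. indicator \<Omega> x *\<^sub>R h x)"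
proof -
  \<comment> \<open>Diagonal choice: one and the same test function has to approximate both the
    function and the gradient, so both tolerances are met at a common index.\<close>
  have "\<exists>p. test_fun \<Omega> (fst p) (snd p) \<and> msq M (\<lambda>x. fst p x - u n x) < inverse (real (Suc n)) \<and>
       msq M (\<lambda>x. snd p x - g n x) < inverse (real (Suc n))" for n
  proof -
    obtain \<phi> d\<phi> where \<phi>: "\<And>k. test_fun \<Omega> (\<phi> k) (d\<phi> k)" "(\<lambda>k. msq M (\<lambda>x. \<phi> k x - u n x)) \<longlonglongrightarrow> 0"
       "(\<lambda>k. msq M (\<lambda>x. d\<phi> k x - g n x)) \<longlonglongrightarrow> 0" using H10D(3)[OF H[of n]] by blast
    have "\<forall>\<^sub>F k in sequentially. msq M (\<lambda>x. \<phi> k x - u n x) < inverse (real (Suc n)) \<and>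
       msq M (\<lambda>x. d\<phi> k x - g n x) < inverse (real (Suc n))"
      by (intro eventually_conj order_tendstoD(2)[OF \<phi>(2)] order_tendstoD(2)[OF \<phi>(3)]) auto
    then obtain k where "msq M (\<lambda>x. \<phi> k x - u n x) < inverse (real (Suc n)) \<and>
       msq M (\<lambda>x. d\<phi> k x - g n x) < inverse (real (Suc n))"
      unfolding eventually_sequentially by blast
    with \<phi>(1)[of k] show ?thesis by (intro exI[of _ "(\<phi> k, d\<phi> k)"]) simp
  qed
  then have "\<forall>n. \<exists>p. test_fun \<Omega> (fst p) (snd p) \<and> msq M (\<lambda>x. fst p x - u n x) < inverse (real (Suc n)) \<and>
       msq M (\<lambda>x. snd p x - g n x) < inverse (real (Suc n))" by blast
  from choice[OF this] obtain p where p: "\<forall>n. test_fun \<Omega> (fst (p n)) (snd (p n)) \<and>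
      msq M (\<lambda>x. fst (p n) x - u n x) < inverse (real (Suc n)) \<and>
      msq M (\<lambda>x. snd (p n) x - g n x) < inverse (real (Suc n))" by blast
  define \<phi> d\<phi> where "\<phi> n = fst (p n)" and "d\<phi> n = snd (p n)" for n
  have \<phi>: "\<And>n. test_fun \<Omega> (\<phi> n) (d\<phi> n)"
    "\<And>n. msq M (\<lambda>x. \<phi> n x - u n x) < inverse (real (Suc n))"
    "\<And>n. msq M (\<lambda>x. d\<phi> n x - g n x) < inverse (real (Suc n))"
    using p by (auto simp: \<phi>_def d\<phi>_def)
  have conv: "(\<lambda>n. msq M (\<lambda>x. f n x - w x)) \<longlonglongrightarrow> 0"
    if "\<And>n. l2 M (f n)" "\<And>n. l2 M (k n)" "l2 M w" "\<And>n. msq M (\<lambda>x. f n x - k n x) < inverse (real (Suc n))"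
      "(\<lambda>n. msq M (\<lambda>x. k n x - w x)) \<longlonglongrightarrow> 0" for f k :: "nat \<Rightarrow> pt \<Rightarrow> 'b::euclidean_space" and w
  proof (rule Lim_null_comparison[OF always_eventually])
    show "(\<lambda>n. 2 * inverse (real (Suc n)) + 2 * msq M (\<lambda>x. k n x - w x)) \<longlonglongrightarrow> 0"
      using tendsto_add[OF tendsto_mult[OF tendsto_const[of 2] LIMSEQ_inverse_real_of_nat]
          tendsto_mult[OF tendsto_const[of 2] that(5)]] by simp
    show "\<forall>n. norm (msq M (\<lambda>x. f n x - w x)) \<le> 2 * inverse (real (Suc n)) + 2 * msq M (\<lambda>x. k n x - w x)"
    proof
      fix n
      show "norm (msq M (\<lambda>x. f n x - w x)) \<le> 2 * inverse (real (Suc n)) + 2 * msq M (\<lambda>x. k n x - w x)"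
        using msq_add_le[OF l2_diff[OF that(1)[of n] that(2)[of n]] l2_diff[OF that(2)[of n] that(3)]] that(4)[of n]
        by simp
    qed
  qed
  have 1: "(\<lambda>n. msq M (\<lambda>x. \<phi> n x - v x)) \<longlonglongrightarrow> 0"
    by (rule conv[OF l2_test_fun(1)[OF \<phi>(1)] H10D(1)[OF H] l(1) \<phi>(2) lim(1)])
  have 2: "(\<lambda>n. msq M (\<lambda>x. d\<phi> n x - h x)) \<longlonglongrightarrow> 0"
    by (rule conv[OF l2_test_fun(2)[OF \<phi>(1)] H10D(2)[OF H] l(2) \<phi>(3) lim(2)])
  have cong: "l2 M (\<lambda>x. indicator \<Omega> x *\<^sub>R f x) \<longleftrightarrow> l2 M f"
    "msq M (\<lambda>x. k x - indicator \<Omega> x *\<^sub>R f x) = msq M (\<lambda>x. k x - f x)" for f k :: "pt \<Rightarrow> 'b::euclidean_space"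
    unfolding l2_def msq_def
    by (auto intro!: arg_cong2[of _ _ _ _ "(\<and>)"] measurable_cong Bochner_Integration.integrable_cong Bochner_Integration.integral_cong)
  show ?thesis
  proof (rule H10I)
    show "test_fun \<Omega> (\<phi> n) (d\<phi> n)" for n by (rule \<phi>)
    show "(\<lambda>x. indicator \<Omega> x *\<^sub>R v x) \<in> borel_measurable lebesgue" "(\<lambda>x. indicator \<Omega> x *\<^sub>R h x) \<in> borel_measurable lebesgue"
      using l2_measurable[OF l(1)] l2_measurable[OF l(2)]
      by (simp_all add: borel_measurable_restrict_space_iff del: real_scaleR_def)
  qed (use l 1 2 in \<open>simp_all only: cong\<close>)
qed

end

section \<open>Poincare's inequality and the cone K\<close>

context bounded_open
begin

text \<open>Integrate $\partial_1(x_1\varphi^2)$ over the domain.\<close>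

lemma poincare_test:
  assumes \<phi>: "test_fun \<Omega> \<phi> d\<phi>" and R: "\<And>x. x \<in> \<Omega> \<Longrightarrow> norm x \<le> R"
  shows "msq M \<phi> \<le> 4 * R\<^sup>2 * msq M d\<phi>"
proof -
  \<comment> \<open>The product x_1 \<phi>^2 is read as \<phi> times x_1 \<phi>, the shape that
    \<open>test_fun_mult\<close> handles; \<open>gY\<close> is the gradient of the second
    factor.\<close>
  define gY where "gY x = (\<phi> x, 0) + fst x *\<^sub>R d\<phi> x" for x
  have Y: "((\<lambda>x. fst x * \<phi> x) has_derivative (\<lambda>v. gY x \<bullet> v)) (at x)" for x
    by (auto intro!: derivative_eq_intros test_funD(2)[OF \<phi>] simp: gY_def inner_prod_def fun_eq_iff algebra_simps)
  have gY: "continuous_on \<Omega> gY"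
    unfolding gY_def using test_funD[OF \<phi>] by (auto intro!: continuous_intros intro: continuous_on_subset)
  note t = test_fun_mult[OF \<phi> opn Y gY]
  have "0 = (\<integral>x. fst (if x \<in> \<Omega> then \<phi> x *\<^sub>R gY x + (fst x * \<phi> x) *\<^sub>R d\<phi> x else 0) \<partial>M)"
    using integral_test_gradient(1)[OF t] by simp
  also have "\<dots> \<ge> (\<integral>x. 1/2 * (norm (\<phi> x))\<^sup>2 - 2 * R\<^sup>2 * (norm (d\<phi> x))\<^sup>2 \<partial>M)"
  proof (rule integral_mono)
    show "integrable M (\<lambda>x. 1/2 * (norm (\<phi> x))\<^sup>2 - 2 * R\<^sup>2 * (norm (d\<phi> x))\<^sup>2)"
      using l2_test_fun[OF \<phi>] by (auto simp: l2_def)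
    show "integrable M (\<lambda>x. fst (if x \<in> \<Omega> then \<phi> x *\<^sub>R gY x + (fst x * \<phi> x) *\<^sub>R d\<phi> x else 0))"
      using l2_inner[OF l2_test_fun(2)[OF t] l2_bounded[of "\<lambda>x. (1,0)" 1]] by (simp add: inner_prod_def)
    fix x assume "x \<in> space M"
    then have x: "x \<in> \<Omega>" by simp
    have "\<bar>fst x\<bar> \<le> R" using R[OF x] norm_fst_le[of "fst x" "snd x"] by simp
    moreover have "\<bar>fst (d\<phi> x)\<bar> \<le> norm (d\<phi> x)" using norm_fst_le[of "fst (d\<phi> x)" "snd (d\<phi> x)"] by simp
    ultimately have "\<bar>fst x * fst (d\<phi> x)\<bar>\<^sup>2 \<le> (R * norm (d\<phi> x))\<^sup>2"
      unfolding abs_mult by (intro power_mono mult_mono) auto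
    then have *: "(fst x * fst (d\<phi> x))\<^sup>2 \<le> R\<^sup>2 * (norm (d\<phi> x))\<^sup>2" by (simp add: power_mult_distrib)
    \<comment> \<open>Young's inequality as a completed square, weighted so that half of \<phi>^2
      survives.\<close>
    have "0 \<le> (\<phi> x + 2 * (fst x * fst (d\<phi> x)))\<^sup>2" by simp
    then have "1/2 * (\<phi> x)\<^sup>2 - 2 * (fst x * fst (d\<phi> x))\<^sup>2 \<le> (\<phi> x)\<^sup>2 + 2 * \<phi> x * (fst x * fst (d\<phi> x))"
      by (simp add: power2_eq_square algebra_simps)
    with * show "1/2 * (norm (\<phi> x))\<^sup>2 - 2 * R\<^sup>2 * (norm (d\<phi> x))\<^sup>2
       \<le> fst (if x \<in> \<Omega> then \<phi> x *\<^sub>R gY x + (fst x * \<phi> x) *\<^sub>R d\<phi> x else 0)"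
      using x by (simp add: gY_def power2_eq_square algebra_simps)
  qed
  also have "(\<integral>x. 1/2 * (norm (\<phi> x))\<^sup>2 - 2 * R\<^sup>2 * (norm (d\<phi> x))\<^sup>2 \<partial>M) = 1/2 * msq M \<phi> - 2 * R\<^sup>2 * msq M d\<phi>"
    using l2_test_fun[OF \<phi>] by (simp add: l2_def msq_def)
  finally show ?thesis by simp
qed

text \<open>Density carries \<open>poincare_test\<close> over to all of H^1_0. Two uses of the
  factor 2 in \<open>msq_add_le\<close> turn 4 R^2 into 16 R^2; only the existence of a constant
  matters.\<close>

lemma poincare:
  obtains P where "P \<ge> 0" "\<And>u g. H10 \<Omega> u g \<Longrightarrow> msq M u \<le> P * msq M g"
proof -
  obtain R where R: "\<And>x. x \<in> \<Omega> \<Longrightarrow> norm x \<le> R" using bounded by (auto simp: bounded_iff)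
  have "msq M u \<le> 16 * R\<^sup>2 * msq M g" if H: "H10 \<Omega> u g" for u g
  proof -
    obtain \<phi> d\<phi> where \<phi>: "\<And>n. test_fun \<Omega> (\<phi> n) (d\<phi> n)" "(\<lambda>n. msq M (\<lambda>x. \<phi> n x - u x)) \<longlonglongrightarrow> 0"
       "(\<lambda>n. msq M (\<lambda>x. d\<phi> n x - g x)) \<longlonglongrightarrow> 0" using H10D(3)[OF H] by blast
    note l = H10D(1,2)[OF H]
    have "msq M u \<le> 2 * msq M (\<lambda>x. \<phi> n x - u x) + 8 * R\<^sup>2 * (2 * msq M (\<lambda>x. d\<phi> n x - g x) + 2 * msq M g)" for n
    proof -
      note t = l2_test_fun[OF \<phi>(1)[of n]]
      have "msq M u \<le> 2 * msq M (\<lambda>x. u x - \<phi> n x) + 2 * msq M (\<phi> n)"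
        using msq_add_le[OF l2_diff[OF l(1) t(1)] t(1)] by simp
      moreover have "8 * R\<^sup>2 * msq M (d\<phi> n) \<le> 8 * R\<^sup>2 * (2 * msq M (\<lambda>x. d\<phi> n x - g x) + 2 * msq M g)"
        using msq_add_le[OF l2_diff[OF t(2) l(2)] l(2)] by (intro mult_left_mono) auto
      ultimately show ?thesis using poincare_test[OF \<phi>(1)[of n] R]
        by (simp add: msq_minus_commute[of M u])
    qed
    moreover have "(\<lambda>n. 2 * msq M (\<lambda>x. \<phi> n x - u x) + 8 * R\<^sup>2 * (2 * msq M (\<lambda>x. d\<phi> n x - g x) + 2 * msq M g))
      \<longlonglongrightarrow> 2 * 0 + 8 * R\<^sup>2 * (2 * 0 + 2 * msq M g)"
      by (intro tendsto_intros \<phi>)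
    ultimately have "msq M u \<le> 2 * 0 + 8 * R\<^sup>2 * (2 * 0 + 2 * msq M g)"
      by (intro LIMSEQ_le_const) auto
    then show ?thesis by simp
  qed
  then show thesis by (intro that[of "16 * R\<^sup>2"]) auto
qed

text \<open>K is a convex cone, so the coefficients need not add up to 1. Minimisation uses convex
  combinations; the supersolution property uses the plain sum of two elements.\<close>

lemma inK_convex:
  assumes "inK \<Omega> u g" "inK \<Omega> v h" "a \<ge> 0" "b \<ge> 0"
  shows "inK \<Omega> (\<lambda>x. a * u x + b * v x) (\<lambda>x. a *\<^sub>R g x + b *\<^sub>R h x)"
proof -
  have "AE x in lebesgue. x \<in> \<Omega> \<longrightarrow> 0 \<le> u x" "AE x in lebesgue. x \<in> \<Omega> \<longrightarrow> 0 \<le> v x"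
    using assms by (auto simp: inK_def)
  then have "AE x in lebesgue. x \<in> \<Omega> \<longrightarrow> 0 \<le> a * u x + b * v x"
    by eventually_elim (use assms in auto)
  then show ?thesis using assms H10_lincomb unfolding inK_def by blast
qed

lemma inK_test: "test_fun \<Omega> \<phi> d\<phi> \<Longrightarrow> (\<And>x. \<phi> x \<ge> 0) \<Longrightarrow> inK \<Omega> \<phi> d\<phi>"
  unfolding inK_def by (auto intro: H10_test)

lemma inK_zero: "inK \<Omega> (\<lambda>x. 0) (\<lambda>x. 0)"
  by (rule inK_test) (auto simp: test_fun_def intro!: exI[of _ "{}"])

lemma inK_l2: "inK \<Omega> u g \<Longrightarrow> l2 M u" "inK \<Omega> u g \<Longrightarrow> l2 M g"
  using H10D by (auto simp: inK_def)

end

subsection \<open>The variational inequality\<close>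

locale film = bounded_open +
  fixes h :: "pt \<Rightarrow> real" and gh :: "pt \<Rightarrow> pt" and H :: real
  assumes h_deriv: "\<And>x. x \<in> \<Omega> \<Longrightarrow> (h has_derivative (\<lambda>v. gh x \<bullet> v)) (at x)"
    and gh_cont: "continuous_on \<Omega> gh"
    and h_nonneg: "\<And>x. x \<in> \<Omega> \<Longrightarrow> 0 \<le> h x"
    and h_le: "\<And>x. x \<in> \<Omega> \<Longrightarrow> h x \<le> H"
    and H_pos: "H > 0"
begin

lemma h_cont: "continuous_on \<Omega> h"
  using h_deriv by (meson continuous_at_imp_continuous_on has_derivative_continuous)

definition w :: "real \<Rightarrow> pt \<Rightarrow> real" where "w \<beta> x = (h x + \<beta>) ^ 3"

lemma w_cont: "continuous_on \<Omega> (w \<beta>)"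
  unfolding w_def by (intro continuous_intros h_cont)

text \<open>Uniform ellipticity for fixed \<beta>: the lower bound gives coercivity, the upper one
  keeps weighted fields square integrable. The lower bound is lost as \<beta> tends to 0.\<close>

lemma w_bounds:
  assumes "x \<in> \<Omega>" "\<beta> > 0"
  shows "\<beta> ^ 3 \<le> w \<beta> x" "w \<beta> x \<le> (H + \<beta>) ^ 3" "0 \<le> w \<beta> x" "\<bar>w \<beta> x\<bar> \<le> (H + \<beta>) ^ 3"
proof -
  show 1: "\<beta> ^ 3 \<le> w \<beta> x" and 2: "w \<beta> x \<le> (H + \<beta>) ^ 3"
    unfolding w_def using assms h_nonneg[of x] h_le[of x] by (auto intro!: power_mono)
  show 3: "0 \<le> w \<beta> x" using 1 assms by (meson less_imp_le order_trans zero_less_power)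
  show "\<bar>w \<beta> x\<bar> \<le> (H + \<beta>) ^ 3" using 2 3 by simp
qed

lemma l2_w: "\<beta> > 0 \<Longrightarrow> l2 M f \<Longrightarrow> l2 M (\<lambda>x. w \<beta> x *\<^sub>R f x)"
  by (rule l2_mult_bounded[OF _ continuous_measurable[OF w_cont]]) (auto intro: w_bounds)

text \<open>Pairing with the field (h, 0) turns the source term \<open>h x * fst (f x)\<close> into
  an inner product, to which Cauchy-Schwarz applies.\<close>

lemma l2_h: "l2 M (\<lambda>x. (h x, 0::real))"
  using h_nonneg h_le by (intro l2_bounded[of _ H] continuous_measurable continuous_intros h_cont) auto

lemma integrable_w_inner:
  "\<beta> > 0 \<Longrightarrow> l2 M f \<Longrightarrow> l2 M g \<Longrightarrow> integrable M (\<lambda>x. w \<beta> x * (f x \<bullet> g x))"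
  using l2_inner[OF l2_w] by simp

lemma integrable_h_fst:
  "l2 M f \<Longrightarrow> integrable M (\<lambda>x. h x * fst (f x :: pt))"
  using l2_inner[OF l2_h] by (simp add: inner_prod_def)

lemma vi_solution_iff:
  "vi_solution \<Omega> h \<beta> 0 q dq \<longleftrightarrow> inK \<Omega> q dq \<and>
     (\<forall>\<phi> d\<phi>. inK \<Omega> \<phi> d\<phi> \<longrightarrow>
       (\<integral>x. h x * fst (d\<phi> x - dq x) \<partial>M) \<le> (\<integral>x. w \<beta> x * (dq x \<bullet> (d\<phi> x - dq x)) \<partial>M))"
  unfolding vi_solution_def set_integral_M w_def by simp

section \<open>Existence of a solution by energy minimisation\<close>

definition energy :: "real \<Rightarrow> (pt \<Rightarrow> pt) \<Rightarrow> real" where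
  "energy \<beta> f = (\<integral>x. w \<beta> x * (f x \<bullet> f x) \<partial>M) - 2 * (\<integral>x. h x * fst (f x) \<partial>M)"

text \<open>The expansion is exact because the energy is quadratic. It serves with \<open>t\<close>
  equal to 1 and -1 for the parallelogram identity and with \<open>t\<close> tending to 0 for the
  first variation. Only gradients enter, since the \<gamma>-term is absent.\<close>

lemma energy_expand:
  assumes "\<beta> > 0" "l2 M f" "l2 M d"
  shows "energy \<beta> (\<lambda>x. f x + t *\<^sub>R d x) = energy \<beta> f
     + 2 * t * ((\<integral>x. w \<beta> x * (f x \<bullet> d x) \<partial>M) - (\<integral>x. h x * fst (d x) \<partial>M))
     + t\<^sup>2 * (\<integral>x. w \<beta> x * (d x \<bullet> d x) \<partial>M)"
proof -
  note i = integrable_w_inner[OF assms(1) assms(2,2)] integrable_w_inner[OF assms(1) assms(2,3)]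
    integrable_w_inner[OF assms(1) assms(3,3)] integrable_h_fst[OF assms(2)] integrable_h_fst[OF assms(3)]
  have "(\<integral>x. w \<beta> x * ((f x + t *\<^sub>R d x) \<bullet> (f x + t *\<^sub>R d x)) \<partial>M)
    = (\<integral>x. w \<beta> x * (f x \<bullet> f x) + 2 * t * (w \<beta> x * (f x \<bullet> d x)) + t\<^sup>2 * (w \<beta> x * (d x \<bullet> d x)) \<partial>M)"
    by (rule Bochner_Integration.integral_cong)
      (auto simp: inner_add_left inner_add_right inner_commute[of "d _" "f _"] power2_eq_square algebra_simps)
  also have "\<dots> = (\<integral>x. w \<beta> x * (f x \<bullet> f x) \<partial>M) + 2 * t * (\<integral>x. w \<beta> x * (f x \<bullet> d x) \<partial>M)
       + t\<^sup>2 * (\<integral>x. w \<beta> x * (d x \<bullet> d x) \<partial>M)"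
    using i by simp
  finally have 1: "(\<integral>x. w \<beta> x * ((f x + t *\<^sub>R d x) \<bullet> (f x + t *\<^sub>R d x)) \<partial>M) = \<dots>" .
  have "(\<integral>x. h x * fst (f x + t *\<^sub>R d x) \<partial>M) = (\<integral>x. h x * fst (f x) + t * (h x * fst (d x)) \<partial>M)"
    by (rule Bochner_Integration.integral_cong) (auto simp: algebra_simps)
  also have "\<dots> = (\<integral>x. h x * fst (f x) \<partial>M) + t * (\<integral>x. h x * fst (d x) \<partial>M)"
    using i by simp
  finally show ?thesis using 1 by (simp add: energy_def algebra_simps)
qed

lemma msq_le_weighted:
  assumes "\<beta> > 0" "l2 M f"
  shows "\<beta> ^ 3 * msq M f \<le> (\<integral>x. w \<beta> x * (f x \<bullet> f x) \<partial>M)"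
proof -
  have "\<beta> ^ 3 * msq M f = (\<integral>x. \<beta> ^ 3 * (norm (f x))\<^sup>2 \<partial>M)" by (simp add: msq_def)
  also have "\<dots> \<le> (\<integral>x. w \<beta> x * (f x \<bullet> f x) \<partial>M)"
    using assms by (intro integral_mono integrable_w_inner)
      (auto simp: l2_def power2_norm_eq_inner intro!: mult_right_mono w_bounds)
  finally show ?thesis .
qed

text \<open>The L^2 norm of the constant 1, which Cauchy-Schwarz produces when an integral is
  bounded by an L^2 norm.\<close>

definition root_area :: real where "root_area = sqrt (measure M \<Omega>)"

lemma sqrt_msq_h_le: "sqrt (msq M (\<lambda>x. (h x, 0::real))) \<le> H * root_area"
proof -
  have "msq M (\<lambda>x. (h x, 0::real)) \<le> (\<integral>x. H\<^sup>2 \<partial>M)"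
    unfolding msq_def using l2_h h_nonneg h_le
    by (intro integral_mono) (auto simp: l2_def intro!: power_mono)
  then have "msq M (\<lambda>x. (h x, 0::real)) \<le> H\<^sup>2 * measure M \<Omega>" by (simp add: mult.commute)
  then have "sqrt (msq M (\<lambda>x. (h x, 0::real))) \<le> sqrt (H\<^sup>2 * measure M \<Omega>)" by (rule real_sqrt_le_mono)
  then show ?thesis using H_pos by (simp add: real_sqrt_mult root_area_def)
qed

lemma integral_h_fst_le:
  assumes "l2 M f"
  shows "\<bar>\<integral>x. h x * fst (f x :: pt) \<partial>M\<bar> \<le> H * root_area * sqrt (msq M f)"
proof -
  have "\<bar>\<integral>x. h x * fst (f x) \<partial>M\<bar> \<le> sqrt (msq M (\<lambda>x. (h x, 0::real))) * sqrt (msq M f)"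
    using l2_Cauchy_Schwarz[OF l2_h assms] by (simp add: inner_prod_def)
  also have "\<dots> \<le> H * root_area * sqrt (msq M f)"
    by (intro mult_right_mono sqrt_msq_h_le) auto
  finally show ?thesis .
qed

text \<open>Coercivity and the bound on the source leave a quadratic polynomial in the L^2 norm
  \<open>t\<close> of the field; completing the square gives its minimum.\<close>

lemma energy_bounded_below:
  assumes "\<beta> > 0" "l2 M f"
  shows "energy \<beta> f \<ge> - (H * root_area)\<^sup>2 / \<beta> ^ 3"
proof -
  define t where "t = sqrt (msq M f)"
  have b: "\<beta> ^ 3 > 0" using assms by simp
  have "\<beta> ^ 3 * t\<^sup>2 - 2 * (H * root_area * t) \<le> energy \<beta> f"
    using msq_le_weighted[OF assms] integral_h_fst_le[OF assms(2)] by (simp add: energy_def t_def)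
  moreover have "\<beta> ^ 3 * (\<beta> ^ 3 * t\<^sup>2 - 2 * (H * root_area * t)) + (H * root_area)\<^sup>2 = (\<beta> ^ 3 * t - H * root_area)\<^sup>2"
    by (simp add: power2_eq_square algebra_simps)
  then have "\<beta> ^ 3 * (\<beta> ^ 3 * t\<^sup>2 - 2 * (H * root_area * t)) \<ge> - (H * root_area)\<^sup>2"
    by (smt (verit) zero_le_power2)
  then have "- (H * root_area)\<^sup>2 / \<beta> ^ 3 \<le> \<beta> ^ 3 * t\<^sup>2 - 2 * (H * root_area * t)"
    using b by (simp only: divide_le_eq mult.commute if_True)
  ultimately show ?thesis by linarith
qed

text \<open>The problem is symmetric, so the solution is the minimiser of the energy over the cone; the
  parallelogram identity makes a minimising sequence Cauchy.\<close>

lemma vi_solution_exists: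
  assumes \<beta>: "\<beta> > 0"
  shows "\<exists>q dq. vi_solution \<Omega> h \<beta> 0 q dq"
proof -
  obtain P where P: "P \<ge> 0" "\<And>u g. H10 \<Omega> u g \<Longrightarrow> msq M u \<le> P * msq M g" by (rule poincare) blast
  define E where "E = {energy \<beta> g | u g. inK \<Omega> u g}"
  define c where "c = Inf E"
  have bdd: "bdd_below E"
    unfolding E_def using energy_bounded_below[OF \<beta>] inK_l2(2) by (force simp: bdd_below_def)
  have c_le: "c \<le> energy \<beta> g" if "inK \<Omega> u g" for u g
    unfolding c_def by (rule cInf_lower[OF _ bdd]) (use that in \<open>auto simp: E_def\<close>)
  \<comment> \<open>The gap (1/16)^n to the infimum is the rate that \<open>l2_complete\<close> asks
    for.\<close>
  have "\<exists>p. inK \<Omega> (fst p) (snd p) \<and> energy \<beta> (snd p) < c + (1/16)^n" for n :: nat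
  proof -
    have "E \<noteq> {}" using inK_zero by (auto simp: E_def)
    moreover have "Inf E < c + (1/16)^n" by (simp add: c_def)
    ultimately obtain e where "e \<in> E" "e < c + (1/16)^n" using cInf_lessD by blast
    then show ?thesis by (auto simp: E_def)
  qed
  then have "\<forall>n. \<exists>p. inK \<Omega> (fst p) (snd p) \<and> energy \<beta> (snd p) < c + (1/16)^n" by blast
  from choice[OF this] obtain p where p: "\<And>n. inK \<Omega> (fst (p n)) (snd (p n))" 
    "\<And>n. energy \<beta> (snd (p n)) < c + (1/16)^n" by blast
  define u g where "u n = fst (p n)" and "g n = snd (p n)" for n
  have K: "inK \<Omega> (u n) (g n)" and e: "energy \<beta> (g n) < c + (1/16)^n" for n
    using p by (auto simp: u_def g_def)
  note l = inK_l2[OF K]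
  have fast: "msq M (\<lambda>x. g (Suc n) x - g n x) \<le> 4 / \<beta>^3 * (1/16)^n" for n
  proof -
    \<comment> \<open>Midpoint and half difference of two consecutive elements. The midpoint lies in
      K, so its energy is at least \<open>c\<close>, and the excess of the two energies bounds the
      quadratic form of \<open>d\<close>.\<close>
    define m where "m x = (1/2) *\<^sub>R g (Suc n) x + (1/2) *\<^sub>R g n x" for x
    define d where "d x = (1/2) *\<^sub>R (g (Suc n) x - g n x)" for x
    have m: "l2 M m" and d: "l2 M d" unfolding m_def d_def by (intro l2_add l2_scaleR l2_diff l)+
    have gm: "g (Suc n) = (\<lambda>x. m x + 1 *\<^sub>R d x)" "g n = (\<lambda>x. m x + (-1) *\<^sub>R d x)"
      by (auto simp: m_def d_def fun_eq_iff algebra_simps simp flip: scaleR_add_left)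
    have "c \<le> energy \<beta> m"
      using c_le[OF inK_convex[OF K[of "Suc n"] K[of n], of "1/2" "1/2"]] by (simp add: m_def[abs_def])
    moreover have "energy \<beta> (g (Suc n)) + energy \<beta> (g n) = 2 * energy \<beta> m + 2 * (\<integral>x. w \<beta> x * (d x \<bullet> d x) \<partial>M)"
      unfolding gm energy_expand[OF \<beta> m d] by simp
    moreover have "energy \<beta> (g (Suc n)) + energy \<beta> (g n) \<le> 2 * c + 2 * (1/16)^n"
    proof -
      have "(1/16 :: real)^Suc n \<le> (1/16)^n" by (rule power_decreasing) auto
      then show ?thesis using e[of "Suc n"] e[of n] by linarith
    qed
    ultimately have "\<beta> ^ 3 * msq M d \<le> (1/16)^n"
      using msq_le_weighted[OF \<beta> d] by linarith
    moreover have "msq M d = 1/4 * msq M (\<lambda>x. g (Suc n) x - g n x)"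
      unfolding d_def msq_scaleR by (simp add: power2_eq_square)
    ultimately show ?thesis using \<beta> by (simp add: field_simps)
  qed
  \<comment> \<open>Poincare's inequality transfers the rate from the gradients to the
    functions.\<close>
  have "msq M (\<lambda>x. u (Suc n) x - u n x) \<le> P * (4 / \<beta>^3) * (1/16)^n" for n
  proof -
    have "H10 \<Omega> (\<lambda>x. u (Suc n) x - u n x) (\<lambda>x. g (Suc n) x - g n x)"
      using H10_lincomb[of "u (Suc n)" "g (Suc n)" "u n" "g n" 1 "-1"] K by (simp add: inK_def)
    from P(2)[OF this] mult_left_mono[OF fast P(1), of n] show ?thesis by (simp add: mult.assoc)
  qed
  from l2_complete[of M u, OF l(1) this] obtain v where v: "l2 M v" "(\<lambda>n. msq M (\<lambda>x. u n x - v x)) \<longlonglongrightarrow> 0"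
    "AE x in M. (\<lambda>n. u n x) \<longlonglongrightarrow> v x" by blast
  from l2_complete[of M g, OF l(2) fast] obtain dv where dv: "l2 M dv" "(\<lambda>n. msq M (\<lambda>x. g n x - dv x)) \<longlonglongrightarrow> 0" by blast
  define q dq where "q = (\<lambda>x. indicator \<Omega> x *\<^sub>R v x)" and "dq = (\<lambda>x. indicator \<Omega> x *\<^sub>R dv x)"
  have "H10 \<Omega> q dq"
    unfolding q_def dq_def using K by (intro H10_closed[of u g] v dv) (auto simp: inK_def)
  moreover have "AE x in lebesgue. x \<in> \<Omega> \<longrightarrow> 0 \<le> q x"
  proof -
    \<comment> \<open>The sign is inherited pointwise; this is what the almost everywhere
      convergence in \<open>l2_complete\<close> is for.\<close>
    have "AE x in M. \<forall>n. 0 \<le> u n x"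
      unfolding AE_all_countable using K by (auto simp: inK_def AE_M)
    then have "AE x in M. 0 \<le> v x" using v(3)
      by eventually_elim (auto intro: LIMSEQ_le_const)
    then have "AE x in M. 0 \<le> q x" by eventually_elim (auto simp: q_def)
    then show ?thesis by (simp add: AE_M)
  qed
  ultimately have Kq: "inK \<Omega> q dq" by (simp add: inK_def)
  note lq = inK_l2[OF Kq]
  have conv: "(\<lambda>n. msq M (\<lambda>x. g n x - dq x)) \<longlonglongrightarrow> 0"
  proof -
    have "msq M (\<lambda>x. g n x - dq x) = msq M (\<lambda>x. g n x - dv x)" for n
      unfolding msq_def by (rule Bochner_Integration.integral_cong) (auto simp: dq_def)
    with dv(2) show ?thesis by simp
  qed
  \<comment> \<open>Half the first variation of the energy at \<open>dq\<close>; the variational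
    inequality says that it is nonnegative in every direction
    \<open>d\<phi> x - dq x\<close>.\<close>
  define A where "A d = (\<integral>x. w \<beta> x * (dq x \<bullet> d x) \<partial>M) - (\<integral>x. h x * fst (d x) \<partial>M)" for d
  have A_inner: "A d = (\<integral>x. d x \<bullet> (w \<beta> x *\<^sub>R dq x - (h x, 0)) \<partial>M)" if "l2 M d" for d
  proof -
    have "A d = (\<integral>x. w \<beta> x * (dq x \<bullet> d x) - h x * fst (d x) \<partial>M)"
      unfolding A_def using that lq \<beta> by (simp add: integrable_w_inner integrable_h_fst)
    then show ?thesis by (simp add: inner_prod_def algebra_simps)
  qed
  \<comment> \<open>Lower semicontinuity: expanding the energy of \<open>g n\<close> around
    \<open>dq\<close>, the quadratic term is dropped for its sign, and the linear term tends to 0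
    because \<open>A\<close> is a continuous functional.\<close>
  have "energy \<beta> dq \<le> c"
  proof (rule LIMSEQ_le_const)
    have "(\<lambda>n. \<integral>x. g n x \<bullet> (w \<beta> x *\<^sub>R dq x - (h x, 0)) \<partial>M) \<longlonglongrightarrow> (\<integral>x. dq x \<bullet> (w \<beta> x *\<^sub>R dq x - (h x, 0)) \<partial>M)"
      by (rule l2_inner_tendsto[OF l(2) lq(2) l2_diff[OF l2_w[OF \<beta> lq(2)] l2_h] conv])
    then have "(\<lambda>n. A (g n) - A dq) \<longlonglongrightarrow> 0"
      unfolding A_inner[OF l(2)] A_inner[OF lq(2)] by (simp add: LIM_zero)
    then have "(\<lambda>n. c + (1/16)^n - 2 * (A (g n) - A dq)) \<longlonglongrightarrow> c + 0 - 2 * 0"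
      by (intro tendsto_intros LIMSEQ_power_zero) auto
    then show "(\<lambda>n. c + (1/16)^n - 2 * (A (g n) - A dq)) \<longlonglongrightarrow> c" by simp
    have "energy \<beta> dq \<le> c + (1/16)^n - 2 * (A (g n) - A dq)" for n
    proof -
      define d where "d x = g n x - dq x" for x
      have d: "l2 M d" unfolding d_def by (intro l2_diff l lq)
      have "energy \<beta> (g n) = energy \<beta> (\<lambda>x. dq x + 1 *\<^sub>R d x)" by (simp add: d_def)
      also have "\<dots> = energy \<beta> dq + 2 * A d + (\<integral>x. w \<beta> x * (d x \<bullet> d x) \<partial>M)"
        unfolding energy_expand[OF \<beta> lq(2) d] A_def by simp
      also have "\<dots> \<ge> energy \<beta> dq + 2 * A d"
        using order_trans[OF _ msq_le_weighted[OF \<beta> d], of 0] \<beta> by simp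
      finally have "energy \<beta> dq + 2 * A d \<le> c + (1/16)^n" using e[of n] by simp
      moreover have "A d = A (g n) - A dq"
        unfolding A_inner[OF d] A_inner[OF l(2)] A_inner[OF lq(2)] d_def
        using l2_inner[OF l(2) l2_diff[OF l2_w[OF \<beta> lq(2)] l2_h]] l2_inner[OF lq(2) l2_diff[OF l2_w[OF \<beta> lq(2)] l2_h]]
        by (simp add: inner_diff_left)
      ultimately show ?thesis by simp
    qed
    then show "\<exists>N. \<forall>n\<ge>N. energy \<beta> dq \<le> c + (1/16)^n - 2 * (A (g n) - A dq)" by blast
  qed
  have "0 \<le> A (\<lambda>x. d\<phi> x - dq x)" if \<phi>: "inK \<Omega> \<phi> d\<phi>" for \<phi> d\<phi>
  proof -
    define d where "d x = d\<phi> x - dq x" for x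
    have d: "l2 M d" unfolding d_def by (intro l2_diff lq inK_l2[OF \<phi>])
    define Q where "Q = (\<integral>x. w \<beta> x * (d x \<bullet> d x) \<partial>M)"
    \<comment> \<open>One factor \<open>t\<close> cancels, so the quadratic remainder disappears as
      \<open>t\<close> tends to 0 from above.\<close>
    have step: "0 \<le> 2 * A d + t * Q" if t: "0 < t" "t \<le> 1" for t
    proof -
      have "(\<lambda>x. t *\<^sub>R d\<phi> x + (1 - t) *\<^sub>R dq x) = (\<lambda>x. dq x + t *\<^sub>R d x)"
        by (simp add: d_def algebra_simps)
      then have "c \<le> energy \<beta> (\<lambda>x. dq x + t *\<^sub>R d x)"
        using c_le[OF inK_convex[OF \<phi> Kq, of t "1 - t"]] t by simp
      also have "\<dots> = energy \<beta> dq + 2 * t * A d + t\<^sup>2 * Q"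
        unfolding energy_expand[OF \<beta> lq(2) d] A_def Q_def ..
      finally have "0 \<le> t * (2 * A d + t * Q)"
        using \<open>energy \<beta> dq \<le> c\<close> by (simp add: power2_eq_square algebra_simps)
      with t show ?thesis by (simp add: zero_le_mult_iff)
    qed
    have "0 \<le> 2 * A d"
    proof (rule tendsto_lowerbound)
      show "((\<lambda>t. 2 * A d + t * Q) \<longlongrightarrow> 2 * A d) (at_right 0)"
        by (auto intro!: tendsto_eq_intros)
      show "\<forall>\<^sub>F t in at_right 0. 0 \<le> 2 * A d + t * Q"
        using eventually_at_right_less[of 0] eventually_at_right[of 0 1]
        by (auto intro!: step eventually_at_rightI[of 0 1])
    qed auto
    then show ?thesis by (simp add: d_def[abs_def])
  qed
  then have "vi_solution \<Omega> h \<beta> 0 q dq"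
    unfolding vi_solution_iff A_def using Kq by auto
  then show ?thesis by blast
qed

section \<open>Dependence of the solution on \<beta>\<close>

lemma vi_gradient_bound:
  assumes \<beta>: "\<beta> > 0" and vi: "vi_solution \<Omega> h \<beta> 0 q dq"
  shows "sqrt (msq M dq) \<le> H * root_area / \<beta> ^ 3"
proof -
  have K: "inK \<Omega> q dq" using vi by (simp add: vi_solution_iff)
  note l = inK_l2[OF K]
  \<comment> \<open>The competitor 0 gives the energy estimate. Coercivity bounds one side below by
    the squared norm of \<open>dq\<close>, Cauchy-Schwarz bounds the other above by a multiple of
    its norm, and one factor cancels.\<close>
  have "(\<integral>x. h x * fst (0 - dq x) \<partial>M) \<le> (\<integral>x. w \<beta> x * (dq x \<bullet> (0 - dq x)) \<partial>M)"
    using vi inK_zero unfolding vi_solution_iff by blast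
  then have "(\<integral>x. w \<beta> x * (dq x \<bullet> dq x) \<partial>M) \<le> (\<integral>x. h x * fst (dq x) \<partial>M)" by simp
  then have "\<beta> ^ 3 * msq M dq \<le> H * root_area * sqrt (msq M dq)"
    using msq_le_weighted[OF \<beta> l(2)] integral_h_fst_le[OF l(2)] by linarith
  then have "sqrt (msq M dq) * (\<beta> ^ 3 * sqrt (msq M dq)) \<le> sqrt (msq M dq) * (H * root_area)"
    by (simp add: mult.commute mult.left_commute)
  then have "msq M dq > 0 \<Longrightarrow> \<beta> ^ 3 * sqrt (msq M dq) \<le> H * root_area"
    by (simp add: mult_le_cancel_left)
  moreover have "msq M dq = 0 \<or> msq M dq > 0" using msq_nonneg[of M dq] by linarith
  moreover have "H * root_area \<ge> 0" using H_pos by (simp add: root_area_def)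
  ultimately have "\<beta> ^ 3 * sqrt (msq M dq) \<le> H * root_area" by auto
  then show ?thesis using \<beta> by (simp add: field_simps)
qed

text \<open>Each solution is used as a test function in the inequality for the other one.\<close>

lemma vi_stability:
  assumes \<beta>: "0 < \<beta>" "\<beta> \<le> B" "0 < \<beta>'" "\<beta>' \<le> B"
    and vi: "vi_solution \<Omega> h \<beta> 0 q dq" "vi_solution \<Omega> h \<beta>' 0 q' dq'"
  shows "sqrt (msq M (\<lambda>x. dq x - dq' x)) \<le> 3 * (H + B)\<^sup>2 * \<bar>\<beta> - \<beta>'\<bar> / \<beta> ^ 3 * sqrt (msq M dq')"
proof -
  have K: "inK \<Omega> q dq" "inK \<Omega> q' dq'" using vi by (auto simp: vi_solution_iff)
  note l = inK_l2(2)[OF K(1)] inK_l2(2)[OF K(2)]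
  define d where "d x = dq x - dq' x" for x
  have d: "l2 M d" unfolding d_def by (intro l2_diff l)
  have "(\<integral>x. h x * fst (dq' x - dq x) \<partial>M) \<le> (\<integral>x. w \<beta> x * (dq x \<bullet> (dq' x - dq x)) \<partial>M)"
    using vi(1) K(2) unfolding vi_solution_iff by blast
  moreover have "h x * fst (dq' x - dq x) = - (h x * fst (d x))" "w \<beta> x * (dq x \<bullet> (dq' x - dq x)) = - (w \<beta> x * (dq x \<bullet> d x))" for x
    by (auto simp: d_def algebra_simps)
  ultimately have 1: "(\<integral>x. w \<beta> x * (dq x \<bullet> d x) \<partial>M) \<le> (\<integral>x. h x * fst (d x) \<partial>M)"
    by simp
  have 2: "(\<integral>x. h x * fst (d x) \<partial>M) \<le> (\<integral>x. w \<beta>' x * (dq' x \<bullet> d x) \<partial>M)"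
    using vi(2) K(1) unfolding vi_solution_iff d_def by blast
  \<comment> \<open>A Lipschitz bound for the cube on [0, H+B]: each of the three terms in a^2 + ab
    + b^2 is at most (H+B)^2.\<close>
  define \<delta> where "\<delta> = 3 * (H + B)\<^sup>2 * \<bar>\<beta> - \<beta>'\<bar>"
  have \<delta>: "\<bar>w \<beta>' x - w \<beta> x\<bar> \<le> \<delta>" if "x \<in> \<Omega>" for x
  proof -
    define a b where "a = h x + \<beta>" and "b = h x + \<beta>'"
    have ab: "0 \<le> a" "a \<le> H + B" "0 \<le> b" "b \<le> H + B"
      using h_nonneg[OF that] h_le[OF that] \<beta> by (auto simp: a_def b_def)
    have "a\<^sup>2 \<le> (H+B)\<^sup>2" "b\<^sup>2 \<le> (H+B)\<^sup>2" "a * b \<le> (H + B) * (H + B)"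
      using ab by (auto intro!: power_mono mult_mono)
    moreover have "0 \<le> a * b" using ab by simp
    ultimately have "\<bar>a\<^sup>2 + a * b + b\<^sup>2\<bar> \<le> 3 * (H+B)\<^sup>2" by (simp add: power2_eq_square)
    then have "\<bar>b - a\<bar> * \<bar>a\<^sup>2 + a * b + b\<^sup>2\<bar> \<le> \<bar>b - a\<bar> * (3 * (H+B)\<^sup>2)"
      by (intro mult_left_mono) auto
    also have "\<bar>b - a\<bar> * \<bar>a\<^sup>2 + a * b + b\<^sup>2\<bar> = \<bar>(b - a) * (a\<^sup>2 + a * b + b\<^sup>2)\<bar>" by (simp only: abs_mult)
    also have "(b - a) * (a\<^sup>2 + a * b + b\<^sup>2) = b ^ 3 - a ^ 3"
      by (simp add: power2_eq_square power3_eq_cube algebra_simps)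
    also have "\<bar>b - a\<bar> * (3 * (H+B)\<^sup>2) = \<delta>"
      by (simp add: a_def b_def \<delta>_def abs_minus_commute mult.commute)
    finally show ?thesis by (simp only: w_def a_def b_def)
  qed
  have "\<delta> \<ge> 0" by (simp add: \<delta>_def)
  have meas: "(\<lambda>x. w \<beta>' x - w \<beta> x) \<in> borel_measurable M"
    by (intro continuous_measurable continuous_intros w_cont)
  have l': "l2 M (\<lambda>x. (w \<beta>' x - w \<beta> x) *\<^sub>R dq' x)"
    by (rule l2_mult_bounded[OF l(2) meas]) (use \<delta> in auto)
  have "\<beta> ^ 3 * msq M d \<le> (\<integral>x. w \<beta> x * (d x \<bullet> d x) \<partial>M)" by (rule msq_le_weighted[OF \<beta>(1) d])
  also have "\<dots> = (\<integral>x. w \<beta> x * (dq x \<bullet> d x) - w \<beta> x * (dq' x \<bullet> d x) \<partial>M)"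
    by (simp add: d_def inner_diff_left algebra_simps)
  also have "\<dots> = (\<integral>x. w \<beta> x * (dq x \<bullet> d x) \<partial>M) - (\<integral>x. w \<beta> x * (dq' x \<bullet> d x) \<partial>M)"
    using integrable_w_inner[OF \<beta>(1) l(1) d] integrable_w_inner[OF \<beta>(1) l(2) d]
      integrable_w_inner[OF \<beta>(3) l(2) d] by simp
  also have "\<dots> \<le> (\<integral>x. w \<beta>' x * (dq' x \<bullet> d x) \<partial>M) - (\<integral>x. w \<beta> x * (dq' x \<bullet> d x) \<partial>M)"
    using 1 2 by linarith
  also have "\<dots> = (\<integral>x. w \<beta>' x * (dq' x \<bullet> d x) - w \<beta> x * (dq' x \<bullet> d x) \<partial>M)"
    using integrable_w_inner[OF \<beta>(1) l(1) d] integrable_w_inner[OF \<beta>(1) l(2) d]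
      integrable_w_inner[OF \<beta>(3) l(2) d] by simp
  also have "\<dots> = (\<integral>x. ((w \<beta>' x - w \<beta> x) *\<^sub>R dq' x) \<bullet> d x \<partial>M)" by (simp add: algebra_simps)
  also have "\<dots> \<le> sqrt (msq M (\<lambda>x. (w \<beta>' x - w \<beta> x) *\<^sub>R dq' x)) * sqrt (msq M d)"
    using l2_Cauchy_Schwarz[OF l' d] by linarith
  also have "\<dots> \<le> (\<delta> * sqrt (msq M dq')) * sqrt (msq M d)"
  proof (rule mult_right_mono)
    have "msq M (\<lambda>x. (w \<beta>' x - w \<beta> x) *\<^sub>R dq' x) \<le> (\<integral>x. \<delta>\<^sup>2 * (norm (dq' x))\<^sup>2 \<partial>M)"
      unfolding msq_def
    proof (rule integral_mono)
      fix x assume "x \<in> space M"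
      then have "\<bar>w \<beta>' x - w \<beta> x\<bar>\<^sup>2 \<le> \<delta>\<^sup>2" using \<delta>[of x] by (intro power_mono) auto
      then show "(norm ((w \<beta>' x - w \<beta> x) *\<^sub>R dq' x))\<^sup>2 \<le> \<delta>\<^sup>2 * (norm (dq' x))\<^sup>2"
        by (simp add: power_mult_distrib mult_right_mono)
    qed (use l' l in \<open>auto simp: l2_def\<close>)
    also have "\<dots> = \<delta>\<^sup>2 * msq M dq'" by (simp add: msq_def)
    finally have "sqrt (msq M (\<lambda>x. (w \<beta>' x - w \<beta> x) *\<^sub>R dq' x)) \<le> sqrt (\<delta>\<^sup>2 * msq M dq')"
      by (rule real_sqrt_le_mono)
    also have "\<dots> = \<delta> * sqrt (msq M dq')" using \<open>\<delta> \<ge> 0\<close> by (simp add: real_sqrt_mult)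
    finally show "sqrt (msq M (\<lambda>x. (w \<beta>' x - w \<beta> x) *\<^sub>R dq' x)) \<le> \<delta> * sqrt (msq M dq')" .
  qed auto
  finally have "sqrt (msq M d) * (\<beta> ^ 3 * sqrt (msq M d)) \<le> sqrt (msq M d) * (\<delta> * sqrt (msq M dq'))"
    by (simp add: mult.commute mult.left_commute)
  then have "msq M d > 0 \<Longrightarrow> \<beta> ^ 3 * sqrt (msq M d) \<le> \<delta> * sqrt (msq M dq')"
    by (simp add: mult_le_cancel_left)
  moreover have "msq M d = 0 \<or> msq M d > 0" using msq_nonneg[of M d] by linarith
  moreover have "\<delta> * sqrt (msq M dq') \<ge> 0" using \<open>\<delta> \<ge> 0\<close> by simp
  ultimately have "\<beta> ^ 3 * sqrt (msq M d) \<le> \<delta> * sqrt (msq M dq')" by auto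
  then show ?thesis using \<beta> by (simp add: d_def[abs_def] \<delta>_def field_simps)
qed

lemma integral_le_msq:
  assumes "l2 M (f :: pt \<Rightarrow> real)"
  shows "\<bar>\<integral>x. f x \<partial>M\<bar> \<le> root_area * sqrt (msq M f)"
proof -
  have "l2 M (\<lambda>x. 1::real)" by (rule l2_bounded[of _ 1]) auto
  from l2_Cauchy_Schwarz[OF this assms] show ?thesis by (simp add: root_area_def msq_def)
qed

text \<open>Cauchy-Schwarz against the constant 1 and Poincare's inequality turn bounds on gradients
  into bounds on loads. At equal parameters the second estimate has right-hand side 0, so it also
  yields uniqueness of the load.\<close>

lemma load_estimates:
  obtains C where "C \<ge> 0"
    "\<And>\<beta> q dq. 0 < \<beta> \<Longrightarrow> vi_solution \<Omega> h \<beta> 0 q dq \<Longrightarrow> \<bar>\<integral>x. q x \<partial>M\<bar> \<le> C / \<beta> ^ 3"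
    "\<And>\<beta> \<beta>' B q q' dq dq'. 0 < \<beta> \<Longrightarrow> \<beta> \<le> B \<Longrightarrow> 0 < \<beta>' \<Longrightarrow> \<beta>' \<le> B \<Longrightarrow> vi_solution \<Omega> h \<beta> 0 q dq \<Longrightarrow>
       vi_solution \<Omega> h \<beta>' 0 q' dq' \<Longrightarrow>
       \<bar>(\<integral>x. q x \<partial>M) - (\<integral>x. q' x \<partial>M)\<bar> \<le> C * (H + B)\<^sup>2 * \<bar>\<beta> - \<beta>'\<bar> / (\<beta> ^ 3 * \<beta>' ^ 3)"
proof -
  obtain P where P: "P \<ge> 0" "\<And>u g. H10 \<Omega> u g \<Longrightarrow> msq M u \<le> P * msq M g" by (rule poincare) blast
  define C where "C = root_area * sqrt P * (H * root_area)"
  have S: "root_area \<ge> 0" by (simp add: root_area_def)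
  have C: "C \<ge> 0" using S H_pos P by (simp add: C_def)
  have *: "\<bar>\<integral>x. u x \<partial>M\<bar> \<le> root_area * sqrt P * sqrt (msq M g)" if "H10 \<Omega> u g" for u g
  proof -
    have "\<bar>\<integral>x. u x \<partial>M\<bar> \<le> root_area * sqrt (msq M u)" by (rule integral_le_msq[OF H10D(1)[OF that]])
    also have "\<dots> \<le> root_area * sqrt (P * msq M g)" by (intro mult_left_mono real_sqrt_le_mono P that S)
    finally show ?thesis by (simp add: real_sqrt_mult)
  qed
  show thesis
  \<comment> \<open>The factor 3 comes from \<open>vi_stability\<close>; the first estimate is
    weakened so that one constant serves both.\<close>
  proof (rule that[of "3 * C"])
    show "3 * C \<ge> 0" using C by simp
    fix \<beta> q dq assume \<beta>: "0 < \<beta>" and vi: "vi_solution \<Omega> h \<beta> 0 q dq"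
    then have "H10 \<Omega> q dq" by (simp add: vi_solution_iff inK_def)
    from *[OF this] have "\<bar>\<integral>x. q x \<partial>M\<bar> \<le> root_area * sqrt P * sqrt (msq M dq)" .
    also have "\<dots> \<le> root_area * sqrt P * (H * root_area / \<beta> ^ 3)"
      using S P by (intro mult_left_mono vi_gradient_bound[OF \<beta> vi]) auto
    also have "\<dots> = C / \<beta> ^ 3" by (simp add: C_def)
    also have "\<dots> \<le> 3 * C / \<beta> ^ 3" using C \<beta> by (intro divide_right_mono) auto
    finally show "\<bar>\<integral>x. q x \<partial>M\<bar> \<le> 3 * C / \<beta> ^ 3" .
  next
    fix \<beta> \<beta>' B q q' dq dq' assume \<beta>: "0 < \<beta>" "\<beta> \<le> B" "0 < \<beta>'" "\<beta>' \<le> B"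
      and vi: "vi_solution \<Omega> h \<beta> 0 q dq" "vi_solution \<Omega> h \<beta>' 0 q' dq'"
    have H10: "H10 \<Omega> q dq" "H10 \<Omega> q' dq'" using vi by (auto simp: vi_solution_iff inK_def)
    have int: "integrable M q" "integrable M q'"
      using l2_inner[OF H10D(1)[OF H10(1)] l2_bounded[of "\<lambda>x. 1" 1]]
        l2_inner[OF H10D(1)[OF H10(2)] l2_bounded[of "\<lambda>x. 1" 1]] by auto
    have "H10 \<Omega> (\<lambda>x. q x - q' x) (\<lambda>x. dq x - dq' x)"
      using H10_lincomb[OF H10, of 1 "-1"] by simp
    from *[OF this] have "\<bar>(\<integral>x. q x \<partial>M) - (\<integral>x. q' x \<partial>M)\<bar> \<le> root_area * sqrt P * sqrt (msq M (\<lambda>x. dq x - dq' x))"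
      using int by simp
    also have "\<dots> \<le> root_area * sqrt P * (3 * (H + B)\<^sup>2 * \<bar>\<beta> - \<beta>'\<bar> / \<beta> ^ 3 * sqrt (msq M dq'))"
      using S P by (intro mult_left_mono vi_stability[OF \<beta> vi]) auto
    also have "\<dots> \<le> root_area * sqrt P * (3 * (H + B)\<^sup>2 * \<bar>\<beta> - \<beta>'\<bar> / \<beta> ^ 3 * (H * root_area / \<beta>' ^ 3))"
      using S P \<beta> by (intro mult_left_mono vi_gradient_bound[OF \<beta>(3) vi(2)]) auto
    also have "\<dots> = 3 * C * (H + B)\<^sup>2 * \<bar>\<beta> - \<beta>'\<bar> / (\<beta> ^ 3 * \<beta>' ^ 3)" by (simp add: C_def)
    finally show "\<bar>(\<integral>x. q x \<partial>M) - (\<integral>x. q' x \<partial>M)\<bar> \<le> 3 * C * (H + B)\<^sup>2 * \<bar>\<beta> - \<beta>'\<bar> / (\<beta> ^ 3 * \<beta>' ^ 3)" .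
  qed
qed

end

subsection \<open>A lower bound for the load\<close>

lemma DERIV_max_power:
  fixes s :: real
  shows "((\<lambda>s. max 0 s ^ Suc (Suc n)) has_field_derivative real (Suc (Suc n)) * max 0 s ^ Suc n) (at s)"
proof -
  consider "s > 0" | "s < 0" | "s = 0" by linarith
  then show ?thesis
  proof cases
    case 1
    have "((\<lambda>s. s ^ Suc (Suc n)) has_field_derivative real (Suc (Suc n)) * max 0 s ^ Suc n) (at s)"
      using DERIV_pow[of "Suc (Suc n)" s] 1 by (simp add: max_def)
    then show ?thesis
      by (rule has_field_derivative_transform_within_open[of _ _ _ "{0<..}"]) (use 1 in auto)
  next
    case 2
    have "((\<lambda>s. 0) has_field_derivative real (Suc (Suc n)) * max 0 s ^ Suc n) (at s)"
      using 2 by (simp add: max_def)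
    then show ?thesis
      by (rule has_field_derivative_transform_within_open[of _ _ _ "{..<0}"]) (use 2 in auto)
  next
    case 3
    \<comment> \<open>At the kink the difference quotient is at most a positive power of |h|; this
      is why the exponent starts at 2.\<close>
    have "((\<lambda>h::real. max 0 h ^ Suc (Suc n) / h) \<longlongrightarrow> 0) (at 0)"
    proof (rule Lim_null_comparison[OF always_eventually])
      show "((\<lambda>h::real. \<bar>h\<bar> ^ Suc n) \<longlongrightarrow> 0) (at 0)"
        by (auto intro!: tendsto_eq_intros)
      show "\<forall>h::real. norm (max 0 h ^ Suc (Suc n) / h) \<le> \<bar>h\<bar> ^ Suc n"
      proof
        fix h :: real
        show "norm (max 0 h ^ Suc (Suc n) / h) \<le> \<bar>h\<bar> ^ Suc n"
        proof (cases "h \<le> 0")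
          case True
          then have "max 0 h = 0" by simp
          moreover have "0 \<le> \<bar>h\<bar> ^ Suc n" by (rule zero_le_power) simp
          ultimately show ?thesis by (simp only: power_0_Suc div_0 norm_zero)
        qed (simp add: max_def)
      qed
    qed
    then show ?thesis using 3 unfolding DERIV_def by simp
  qed
qed

text \<open>The cube makes the bump twice continuously differentiable, so that the divergence of
  $(h+\beta)^3\nabla\psi$ is a bounded function.\<close>

definition bump :: "real \<Rightarrow> real" where "bump t = max 0 (1 - t\<^sup>2) ^ 3"
definition bump' :: "real \<Rightarrow> real" where "bump' t = - 6 * t * max 0 (1 - t\<^sup>2) ^ 2"
definition bump'' :: "real \<Rightarrow> real" where
  "bump'' t = - 6 * max 0 (1 - t\<^sup>2) ^ 2 + 24 * t\<^sup>2 * max 0 (1 - t\<^sup>2)"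

lemma DERIV_bump: "(bump has_field_derivative bump' t) (at t)"
proof -
  have "((\<lambda>t. max 0 (1 - t\<^sup>2) ^ Suc (Suc 1)) has_field_derivative
      real (Suc (Suc 1)) * max 0 (1 - t\<^sup>2) ^ Suc 1 * (- (2 * t))) (at t)"
    by (rule DERIV_chain2[OF DERIV_max_power]) (auto intro!: derivative_eq_intros)
  then show ?thesis unfolding bump_def[abs_def] bump'_def by (simp add: eval_nat_numeral algebra_simps)
qed

lemma DERIV_bump': "(bump' has_field_derivative bump'' t) (at t)"
proof -
  have "((\<lambda>t. max 0 (1 - t\<^sup>2) ^ Suc (Suc 0)) has_field_derivative
      real (Suc (Suc 0)) * max 0 (1 - t\<^sup>2) ^ Suc 0 * (- (2 * t))) (at t)"
    by (rule DERIV_chain2[OF DERIV_max_power]) (auto intro!: derivative_eq_intros)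
  then have 1: "((\<lambda>t. max 0 (1 - t\<^sup>2) ^ 2) has_field_derivative - 4 * t * max 0 (1 - t\<^sup>2)) (at t)"
    by (simp add: eval_nat_numeral algebra_simps)
  show ?thesis unfolding bump'_def[abs_def] bump''_def
    by (rule derivative_eq_intros 1 refl)+ (simp add: power2_eq_square algebra_simps)
qed

lemma bump_cont: "continuous_on A bump" "continuous_on A bump'" "continuous_on A bump''"
  unfolding bump_def[abs_def] bump'_def[abs_def] bump''_def[abs_def] by (intro continuous_intros)+

lemma bump_zero:
  assumes "\<bar>t\<bar> \<ge> 1"
  shows "bump t = 0" "bump' t = 0" "bump'' t = 0"
proof -
  have "1 \<le> t\<^sup>2" using assms by (metis abs_le_square_iff abs_one one_power2)
  then show "bump t = 0" "bump' t = 0" "bump'' t = 0" by (auto simp: bump_def bump'_def bump''_def)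
qed

text \<open>For |t| < 1 both |t| and 1 - t^2 are at most 1, so only the coefficients count: 6 for
  \<open>bump'\<close> and 6 + 24 for \<open>bump''\<close>.\<close>

lemma bump_bounds: "0 \<le> bump t" "bump t \<le> 1" "\<bar>bump' t\<bar> \<le> 6" "\<bar>bump'' t\<bar> \<le> 30"
proof -
  define p where "p = max 0 (1 - t\<^sup>2)"
  have p: "0 \<le> p" "p \<le> 1" by (auto simp: p_def)
  then have p2: "0 \<le> p\<^sup>2" "p\<^sup>2 \<le> 1" "p ^ 3 \<le> 1" by (auto intro: power_le_one)
  show "0 \<le> bump t" "bump t \<le> 1" using p p2 by (auto simp: bump_def p_def)
  have "\<bar>bump' t\<bar> \<le> 6 \<and> \<bar>bump'' t\<bar> \<le> 30"
  proof (cases "\<bar>t\<bar> \<ge> 1")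
    case False
    then have "\<bar>t\<bar> * p\<^sup>2 \<le> 1 * 1" "\<bar>t\<bar> * \<bar>t\<bar> \<le> 1 * 1" using p p2 by (intro mult_mono; simp)+
    then have t: "\<bar>t\<bar> * p\<^sup>2 \<le> 1" "t\<^sup>2 \<le> 1" by (auto simp: power2_eq_square abs_mult_self_eq)
    then have "t\<^sup>2 * p \<le> 1 * 1" using p by (intro mult_mono) auto
    moreover have "0 \<le> t\<^sup>2 * p" using p by simp
    moreover have "bump'' t = - 6 * p\<^sup>2 + 24 * (t\<^sup>2 * p)" by (simp add: bump''_def p_def)
    ultimately have "\<bar>bump'' t\<bar> \<le> 30" using p2 by linarith
    moreover have "\<bar>bump' t\<bar> = 6 * (\<bar>t\<bar> * p\<^sup>2)" by (simp add: bump'_def p_def abs_mult)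
    ultimately show ?thesis using t by linarith
  qed (auto simp: bump_zero)
  then show "\<bar>bump' t\<bar> \<le> 6" "\<bar>bump'' t\<bar> \<le> 30" by auto
qed

text \<open>Since (3/4)^3 = 27/64 exceeds 1/4. A product of two such factors gives the 1/16 in
  \<open>load_lower_bound\<close>.\<close>

lemma bump_ge:
  assumes "\<bar>t\<bar> \<le> 1/2"
  shows "1/4 \<le> bump t"
proof -
  have "\<bar>t\<bar>\<^sup>2 \<le> (1/2)\<^sup>2" using assms by (intro power_mono) auto
  then have "(3/4)^3 \<le> max 0 (1 - t\<^sup>2) ^ 3" by (intro power_mono) (auto simp: power2_eq_square)
  then show ?thesis by (simp add: bump_def eval_nat_numeral)
qed

section \<open>Testing the inequality with a bump\<close>

context film
begin

lemma w_deriv: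
  assumes "x \<in> \<Omega>"
  shows "(w \<beta> has_derivative (\<lambda>v. ((3 * (h x + \<beta>)\<^sup>2) *\<^sub>R gh x) \<bullet> v)) (at x)"
  unfolding w_def[abs_def]
  by (auto intro!: derivative_eq_intros h_deriv[OF assms] simp: eval_nat_numeral algebra_simps)

text \<open>The first partial derivative of the test function h \<psi> integrates to zero. The
  locale puts no bound on \<open>gh\<close>, so integrability is read off the same pointwise
  identity.\<close>

lemma test_load:
  assumes \<psi>: "test_fun \<Omega> \<psi> d\<psi>"
  shows "(\<integral>x. h x * fst (d\<psi> x) \<partial>M) = (\<integral>x. \<psi> x * - fst (gh x) \<partial>M)"
    and "integrable M (\<lambda>x. \<psi> x * - fst (gh x))"
proof -
  note t = test_fun_mult[OF \<psi> opn h_deriv gh_cont]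
  define G where "G x = (if x \<in> \<Omega> then \<psi> x *\<^sub>R gh x + h x *\<^sub>R d\<psi> x else 0)" for x
  have int: "integrable M (\<lambda>x. fst (G x))"
    using l2_inner[OF l2_test_fun(2)[OF t] l2_bounded[of "\<lambda>x. (1,0)" 1]] by (simp add: inner_prod_def G_def)
  have eq: "\<psi> x * - fst (gh x) = h x * fst (d\<psi> x) - fst (G x)" if "x \<in> \<Omega>" for x
    using that by (simp add: G_def)
  note ih = integrable_h_fst[OF l2_test_fun(2)[OF \<psi>]]
  have "integrable M (\<lambda>x. h x * fst (d\<psi> x) - fst (G x))" using ih int by simp
  then show "integrable M (\<lambda>x. \<psi> x * - fst (gh x))"
    by (rule iffD1[OF Bochner_Integration.integrable_cong, rotated -1]) (use eq in auto)
  have "(\<integral>x. \<psi> x * - fst (gh x) \<partial>M) = (\<integral>x. h x * fst (d\<psi> x) - fst (G x) \<partial>M)"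
    by (rule Bochner_Integration.integral_cong) (use eq in auto)
  also have "\<dots> = (\<integral>x. h x * fst (d\<psi> x) \<partial>M)"
    using ih int integral_test_gradient(1)[OF t] by (simp add: G_def)
  finally show "(\<integral>x. h x * fst (d\<psi> x) \<partial>M) = (\<integral>x. \<psi> x * - fst (gh x) \<partial>M)" ..
qed

text \<open>\<open>D\<close> is the divergence of w \<nabla>\<psi>. For a test function in place of
  \<open>q\<close> the identity is the divergence theorem, one component at a time; both sides are
  L^2-continuous, so density extends it to H^1_0.\<close>

lemma H10_green:
  assumes \<beta>: "\<beta> > 0" and H: "H10 \<Omega> q dq" and \<psi>: "test_fun \<Omega> \<psi> d\<psi>"
    and d1: "\<And>x. x \<in> \<Omega> \<Longrightarrow> ((\<lambda>x. fst (d\<psi> x)) has_derivative (\<lambda>v. g1 x \<bullet> v)) (at x)" "continuous_on \<Omega> g1"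
    and d2: "\<And>x. x \<in> \<Omega> \<Longrightarrow> ((\<lambda>x. snd (d\<psi> x)) has_derivative (\<lambda>v. g2 x \<bullet> v)) (at x)" "continuous_on \<Omega> g2"
    and D_def: "\<And>x. D x = 3 * (h x + \<beta>)\<^sup>2 * (gh x \<bullet> d\<psi> x) + w \<beta> x * (fst (g1 x) + snd (g2 x))"
    and D: "l2 M D"
  shows "(\<integral>x. w \<beta> x * (dq x \<bullet> d\<psi> x) \<partial>M) = (\<integral>x. q x * - D x \<partial>M)"
proof -
  have l\<psi>: "l2 M (\<lambda>x. w \<beta> x *\<^sub>R d\<psi> x)" by (rule l2_w[OF \<beta> l2_test_fun(2)[OF \<psi>]])
  have test: "(\<integral>x. d\<phi> x \<bullet> (w \<beta> x *\<^sub>R d\<psi> x) \<partial>M) + (\<integral>x. \<phi> x \<bullet> D x \<partial>M) = 0" if \<phi>: "test_fun \<Omega> \<phi> d\<phi>" for \<phi> d\<phi>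
  proof -
    define Y1 Y2 where "Y1 x = w \<beta> x * fst (d\<psi> x)" and "Y2 x = w \<beta> x * snd (d\<psi> x)" for x
    define k where "k x = (3 * (h x + \<beta>)\<^sup>2) *\<^sub>R gh x" for x
    define G1 G2 where "G1 x = fst (d\<psi> x) *\<^sub>R k x + w \<beta> x *\<^sub>R g1 x" 
      and "G2 x = snd (d\<psi> x) *\<^sub>R k x + w \<beta> x *\<^sub>R g2 x" for x
    have Y1: "(Y1 has_derivative (\<lambda>v. G1 x \<bullet> v)) (at x)" if "x \<in> \<Omega>" for x
      unfolding Y1_def[abs_def] G1_def k_def
      by (rule derivative_eq_intros w_deriv d1 that refl)+ (simp add: fun_eq_iff algebra_simps)
    have Y2: "(Y2 has_derivative (\<lambda>v. G2 x \<bullet> v)) (at x)" if "x \<in> \<Omega>" for x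
      unfolding Y2_def[abs_def] G2_def k_def
      by (rule derivative_eq_intros w_deriv d2 that refl)+ (simp add: fun_eq_iff algebra_simps)
    have c: "continuous_on \<Omega> d\<psi>" using test_funD(1)[OF \<psi>] by (rule continuous_on_subset) auto
    have c1: "continuous_on \<Omega> G1" "continuous_on \<Omega> G2"
      unfolding G1_def k_def G2_def by (intro continuous_intros c w_cont gh_cont h_cont d1 d2)+
    define T1 T2 where "T1 x = (if x \<in> \<Omega> then \<phi> x *\<^sub>R G1 x + Y1 x *\<^sub>R d\<phi> x else 0)"
      and "T2 x = (if x \<in> \<Omega> then \<phi> x *\<^sub>R G2 x + Y2 x *\<^sub>R d\<phi> x else 0)" for x
    have T: "test_fun \<Omega> (\<lambda>x. \<phi> x * Y1 x) T1" "test_fun \<Omega> (\<lambda>x. \<phi> x * Y2 x) T2"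
      unfolding T1_def T2_def by (rule test_fun_mult[OF \<phi> opn Y1 c1(1)], assumption, rule test_fun_mult[OF \<phi> opn Y2 c1(2)])
    have int: "integrable M (\<lambda>x. fst (T1 x))" "integrable M (\<lambda>x. snd (T2 x))"
      using l2_inner[OF l2_test_fun(2)[OF T(1)] l2_bounded[of "\<lambda>x. (1,0)" 1]]
        l2_inner[OF l2_test_fun(2)[OF T(2)] l2_bounded[of "\<lambda>x. (0,1)" 1]] by (simp_all add: inner_prod_def)
    have "0 = (\<integral>x. fst (T1 x) + snd (T2 x) \<partial>M)"
      using int integral_test_gradient(1)[OF T(1)] integral_test_gradient(2)[OF T(2)] by simp
    also have "\<dots> = (\<integral>x. d\<phi> x \<bullet> (w \<beta> x *\<^sub>R d\<psi> x) + \<phi> x \<bullet> D x \<partial>M)"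
      by (rule Bochner_Integration.integral_cong)
        (auto simp: T1_def T2_def G1_def G2_def Y1_def Y2_def k_def D_def inner_prod_def algebra_simps)
    also have "\<dots> = (\<integral>x. d\<phi> x \<bullet> (w \<beta> x *\<^sub>R d\<psi> x) \<partial>M) + (\<integral>x. \<phi> x \<bullet> D x \<partial>M)"
      using l2_inner[OF l2_test_fun(2)[OF \<phi>] l\<psi>] l2_inner[OF l2_test_fun(1)[OF \<phi>] D]
      by (rule Bochner_Integration.integral_add)
    finally show ?thesis by simp
  qed
  obtain \<phi> d\<phi> where \<phi>: "\<And>n. test_fun \<Omega> (\<phi> n) (d\<phi> n)" "(\<lambda>n. msq M (\<lambda>x. \<phi> n x - q x)) \<longlonglongrightarrow> 0"
       "(\<lambda>n. msq M (\<lambda>x. d\<phi> n x - dq x)) \<longlonglongrightarrow> 0" using H10D(3)[OF H] by blast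
  have "(\<lambda>n. (\<integral>x. d\<phi> n x \<bullet> (w \<beta> x *\<^sub>R d\<psi> x) \<partial>M) + (\<integral>x. \<phi> n x \<bullet> D x \<partial>M))
    \<longlonglongrightarrow> (\<integral>x. dq x \<bullet> (w \<beta> x *\<^sub>R d\<psi> x) \<partial>M) + (\<integral>x. q x \<bullet> D x \<partial>M)"
    by (intro tendsto_add l2_inner_tendsto l2_test_fun[OF \<phi>(1)] H10D[OF H] l\<psi> D \<phi>)
  then have "(\<integral>x. dq x \<bullet> (w \<beta> x *\<^sub>R d\<psi> x) \<partial>M) + (\<integral>x. q x \<bullet> D x \<partial>M) = 0"
    unfolding test[OF \<phi>(1)] by (simp add: LIMSEQ_const_iff)
  then show ?thesis by simp
qed

lemma vi_supersolution:
  assumes vi: "vi_solution \<Omega> h \<beta> 0 q dq" and \<psi>: "inK \<Omega> \<psi> d\<psi>"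
  shows "(\<integral>x. h x * fst (d\<psi> x) \<partial>M) \<le> (\<integral>x. w \<beta> x * (dq x \<bullet> d\<psi> x) \<partial>M)"
proof -
  have K: "inK \<Omega> q dq" using vi by (simp add: vi_solution_iff)
  have "inK \<Omega> (\<lambda>x. q x + \<psi> x) (\<lambda>x. dq x + d\<psi> x)" using inK_convex[OF K \<psi>, of 1 1] by simp
  then have "(\<integral>x. h x * fst ((dq x + d\<psi> x) - dq x) \<partial>M) \<le> (\<integral>x. w \<beta> x * (dq x \<bullet> ((dq x + d\<psi> x) - dq x)) \<partial>M)"
    using vi unfolding vi_solution_iff by blast
  then show ?thesis by simp
qed

text \<open>Test with a bump $\psi$ on the rectangle. Since $q \ge 0$, the left-hand side of the
  supersolution inequality is at most $\sup|\mathrm{div}((h+\beta)^3\nabla\psi)|$ times the integral of $q$.\<close>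

lemma load_lower_bound:
  assumes \<beta>: "\<beta> > 0" and vi: "vi_solution \<Omega> h \<beta> 0 q dq"
    and \<epsilon>: "0 < \<epsilon>" "\<epsilon> \<le> b"
    and R: "\<And>x. \<bar>fst x - a\<bar> \<le> \<epsilon> \<Longrightarrow> \<bar>snd x\<bar> \<le> b \<Longrightarrow> x \<in> \<Omega>"
    and bounds: "\<And>x. \<bar>fst x - a\<bar> \<le> \<epsilon> \<Longrightarrow> \<bar>snd x\<bar> \<le> b \<Longrightarrow> h x + \<beta> \<le> h1"
      "\<And>x. \<bar>fst x - a\<bar> \<le> \<epsilon> \<Longrightarrow> \<bar>snd x\<bar> \<le> b \<Longrightarrow> norm (gh x) \<le> d1"
      "\<And>x. \<bar>fst x - a\<bar> \<le> \<epsilon> \<Longrightarrow> \<bar>snd x\<bar> \<le> b \<Longrightarrow> m \<le> - fst (gh x)"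
    and m: "0 \<le> m"
  shows "m * (\<epsilon> * b) / 16 \<le> (36 * h1\<^sup>2 * d1 / \<epsilon> + 60 * h1 ^ 3 / \<epsilon>\<^sup>2) * (\<integral>x. q x \<partial>M)"
proof -
  have b: "0 < b" using \<epsilon> by simp
  define X Y where "X x = (fst x - a) / \<epsilon>" and "Y x = snd x / b" for x :: pt
  define \<psi> where "\<psi> x = bump (X x) * bump (Y x)" for x
  define d\<psi> where "d\<psi> x = (bump' (X x) / \<epsilon> * bump (Y x), bump (X x) * (bump' (Y x) / b))" for x
  define g1 where "g1 x = (bump'' (X x) / \<epsilon>\<^sup>2 * bump (Y x), bump' (X x) / \<epsilon> * (bump' (Y x) / b))" for x
  define g2 where "g2 x = (bump' (X x) / \<epsilon> * (bump' (Y x) / b), bump (X x) * (bump'' (Y x) / b\<^sup>2))" for x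
  have XY: "(X has_derivative (\<lambda>v. fst v / \<epsilon>)) (at x)" "(Y has_derivative (\<lambda>v. snd v / b)) (at x)" for x
    unfolding X_def[abs_def] Y_def[abs_def] using \<epsilon> b by (auto intro!: derivative_eq_intros)
  have XYc: "continuous_on A X" "continuous_on A Y" for A
    unfolding X_def[abs_def] Y_def[abs_def] using \<epsilon> b by (auto intro!: continuous_intros)
  note chain = DERIV_compose_FDERIV[where f=bump, OF DERIV_bump] DERIV_compose_FDERIV[where f=bump', OF DERIV_bump']
  note cc = bump_cont[THEN continuous_on_compose2, OF _ subset_UNIV]
  have c: "continuous_on UNIV d\<psi>" "continuous_on \<Omega> g1" "continuous_on \<Omega> g2"
    unfolding d\<psi>_def g1_def g2_def using \<epsilon> b by (intro continuous_intros cc XYc; simp)+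
  have D\<psi>: "(\<psi> has_derivative (\<lambda>v. d\<psi> x \<bullet> v)) (at x)" for x
    unfolding \<psi>_def[abs_def] d\<psi>_def
    by (rule derivative_eq_intros chain XY refl)+ (simp add: fun_eq_iff inner_prod_def algebra_simps)
  have D1: "((\<lambda>x. fst (d\<psi> x)) has_derivative (\<lambda>v. g1 x \<bullet> v)) (at x)" for x
    unfolding d\<psi>_def g1_def fst_conv using \<epsilon> b
    by (auto intro!: derivative_eq_intros chain XY simp: fun_eq_iff inner_prod_def power2_eq_square algebra_simps add_divide_distrib)
  have D2: "((\<lambda>x. snd (d\<psi> x)) has_derivative (\<lambda>v. g2 x \<bullet> v)) (at x)" for x
    unfolding d\<psi>_def g2_def snd_conv using \<epsilon> b
    by (auto intro!: derivative_eq_intros chain XY simp: fun_eq_iff inner_prod_def power2_eq_square algebra_simps add_divide_distrib)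
  define C where "C = cbox (a - \<epsilon>, - b) (a + \<epsilon>, b)"
  have C: "x \<in> C \<longleftrightarrow> \<bar>fst x - a\<bar> \<le> \<epsilon> \<and> \<bar>snd x\<bar> \<le> b" for x
    by (cases x) (auto simp: C_def cbox_Pair_eq)
  have out: "\<psi> x = 0 \<and> d\<psi> x = 0 \<and> g1 x = 0 \<and> g2 x = 0" if "x \<notin> C" for x
  proof -
    have "\<bar>X x\<bar> \<ge> 1 \<or> \<bar>Y x\<bar> \<ge> 1" using that \<epsilon> b by (auto simp: C X_def Y_def abs_divide)
    then show ?thesis by (auto simp: \<psi>_def d\<psi>_def g1_def g2_def bump_zero zero_prod_def)
  qed
  have C\<Omega>: "C \<subseteq> \<Omega>" using R by (auto simp: C)
  have test: "test_fun \<Omega> \<psi> d\<psi>"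
    unfolding test_fun_def using c(1) D\<psi> C\<Omega> out compact_cbox[of "(a - \<epsilon>, - b)" "(a + \<epsilon>, b)", folded C_def] by blast
  have \<psi>0: "0 \<le> \<psi> x" for x using bump_bounds(1) by (simp add: \<psi>_def)
  define D where "D x = 3 * (h x + \<beta>)\<^sup>2 * (gh x \<bullet> d\<psi> x) + w \<beta> x * (fst (g1 x) + snd (g2 x))" for x
  \<comment> \<open>36 = 3 * 12, where 12/\<epsilon> bounds the gradient of \<psi> (6/\<epsilon> per
    direction), and 60/\<epsilon>^2 bounds its Laplacian (30/\<epsilon>^2 per direction). The
    assumption \<epsilon> \<le> b absorbs the x_2-derivatives.\<close>
  define \<Lambda> where "\<Lambda> = 36 * h1\<^sup>2 * d1 / \<epsilon> + 60 * h1 ^ 3 / \<epsilon>\<^sup>2"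
  have aC: "(a, 0) \<in> C" using \<epsilon> b by (simp add: C)
  have h1: "0 \<le> h1" using bounds(1)[of "(a,0)"] h_nonneg[of "(a,0)"] aC C\<Omega> \<beta> \<epsilon> b by fastforce
  have d1: "0 \<le> d1" using order_trans[OF norm_ge_zero bounds(2)[of "(a,0)"]] \<epsilon> b by simp
  have "0 \<le> \<Lambda>" using h1 d1 \<epsilon> by (simp add: \<Lambda>_def)
  have D_le: "\<bar>D x\<bar> \<le> \<Lambda>" for x
  proof (cases "x \<in> C")
    case True
    then have x: "\<bar>fst x - a\<bar> \<le> \<epsilon>" "\<bar>snd x\<bar> \<le> b" "x \<in> \<Omega>" using C[of x] C\<Omega> by blast+
    have inv: "1 / b \<le> 1 / \<epsilon>" "1 / b\<^sup>2 \<le> 1 / \<epsilon>\<^sup>2" using \<epsilon> b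
      by (auto intro!: divide_left_mono power_mono mult_pos_pos)
    have hx: "0 \<le> h x + \<beta>" "h x + \<beta> \<le> h1" using h_nonneg[OF x(3)] \<beta> bounds(1)[OF x(1,2)] by auto
    have "norm (d\<psi> x) \<le> \<bar>bump' (X x) / \<epsilon> * bump (Y x)\<bar> + \<bar>bump (X x) * (bump' (Y x) / b)\<bar>"
      unfolding d\<psi>_def using norm_Pair_le[of "bump' (X x) / \<epsilon> * bump (Y x)" "bump (X x) * (bump' (Y x) / b)"] by simp
    also have "\<dots> = \<bar>bump' (X x)\<bar> * bump (Y x) * (1 / \<epsilon>) + bump (X x) * \<bar>bump' (Y x)\<bar> * (1 / b)"
      using \<epsilon> b bump_bounds(1) by (simp add: abs_mult)
    also have "\<dots> \<le> 6 * 1 * (1 / \<epsilon>) + 1 * 6 * (1 / \<epsilon>)"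
      using \<epsilon> b by (intro add_mono mult_mono bump_bounds inv) (auto simp: bump_bounds)
    finally have nd: "norm (d\<psi> x) \<le> 12 / \<epsilon>" by simp
    have "\<bar>fst (g1 x) + snd (g2 x)\<bar> \<le> \<bar>bump'' (X x)\<bar> * bump (Y x) * (1 / \<epsilon>\<^sup>2) + bump (X x) * \<bar>bump'' (Y x)\<bar> * (1 / b\<^sup>2)"
      unfolding g1_def g2_def using bump_bounds(1) abs_triangle_ineq[of "bump'' (X x) / \<epsilon>\<^sup>2 * bump (Y x)" "bump (X x) * (bump'' (Y x) / b\<^sup>2)"]
      by (simp add: abs_mult)
    also have "\<dots> \<le> 30 * 1 * (1 / \<epsilon>\<^sup>2) + 1 * 30 * (1 / \<epsilon>\<^sup>2)"
      using \<epsilon> b by (intro add_mono mult_mono bump_bounds inv) (auto simp: bump_bounds)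
    finally have ng: "\<bar>fst (g1 x) + snd (g2 x)\<bar> \<le> 60 / \<epsilon>\<^sup>2" by simp
    have "\<bar>D x\<bar> \<le> 3 * (h x + \<beta>)\<^sup>2 * \<bar>gh x \<bullet> d\<psi> x\<bar> + (h x + \<beta>) ^ 3 * \<bar>fst (g1 x) + snd (g2 x)\<bar>"
      unfolding D_def w_def using hx abs_triangle_ineq[of "3 * (h x + \<beta>)\<^sup>2 * (gh x \<bullet> d\<psi> x)" "(h x + \<beta>) ^ 3 * (fst (g1 x) + snd (g2 x))"]
      by (simp add: abs_mult)
    also have "\<dots> \<le> 3 * h1\<^sup>2 * (d1 * (12 / \<epsilon>)) + h1 ^ 3 * (60 / \<epsilon>\<^sup>2)"
    proof (intro add_mono mult_mono power_mono ng hx order_refl)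
      have "\<bar>gh x \<bullet> d\<psi> x\<bar> \<le> norm (gh x) * norm (d\<psi> x)" by (rule Cauchy_Schwarz_ineq2)
      also have "\<dots> \<le> d1 * (12 / \<epsilon>)" using bounds(2)[OF x(1,2)] nd d1 by (intro mult_mono) auto
      finally show "\<bar>gh x \<bullet> d\<psi> x\<bar> \<le> d1 * (12 / \<epsilon>)" .
    qed (use h1 hx in auto)
    also have "\<dots> = \<Lambda>" by (simp add: \<Lambda>_def mult.commute)
    finally show ?thesis .
  next
    case False
    then show ?thesis using out[of x] \<open>0 \<le> \<Lambda>\<close> by (simp add: D_def)
  qed
  have D_meas: "D \<in> borel_measurable M"
    unfolding D_def[abs_def]
    by (intro continuous_measurable continuous_intros h_cont gh_cont w_cont c continuous_on_subset[OF c(1)]) auto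
  have D_l2: "l2 M D" by (rule l2_bounded[OF D_meas]) (use D_le in auto)
  have K: "inK \<Omega> q dq" using vi by (simp add: vi_solution_iff)
  have q0: "AE x in M. 0 \<le> q x" using K by (simp add: inK_def AE_M)
  note lq = inK_l2(1)[OF K]
  have iq: "integrable M q" using l2_inner[OF lq l2_bounded[of "\<lambda>x. 1" 1]] by simp
  \<comment> \<open>The concentric rectangle of half size: its area is \<epsilon> b and \<psi> is at
    least 1/16 on it.\<close>
  define R' where "R' = cbox (a - \<epsilon>/2, - b/2) (a + \<epsilon>/2, b/2)"
  have R': "x \<in> R' \<longleftrightarrow> \<bar>fst x - a\<bar> \<le> \<epsilon>/2 \<and> \<bar>snd x\<bar> \<le> b/2" for x
  proof -
    have "x \<in> R' \<longleftrightarrow> a - \<epsilon>/2 \<le> fst x \<and> fst x \<le> a + \<epsilon>/2 \<and> - (b/2) \<le> snd x \<and> snd x \<le> b/2"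
      by (cases x) (simp add: R'_def cbox_Pair_eq)
    moreover have "\<bar>fst x - a\<bar> \<le> \<epsilon>/2 \<longleftrightarrow> a - \<epsilon>/2 \<le> fst x \<and> fst x \<le> a + \<epsilon>/2"
      unfolding abs_diff_le_iff ..
    moreover have "\<bar>snd x\<bar> \<le> b/2 \<longleftrightarrow> - (b/2) \<le> snd x \<and> snd x \<le> b/2"
      unfolding abs_le_iff by linarith
    ultimately show ?thesis by blast
  qed
  have R'\<Omega>: "R' \<subseteq> \<Omega>" using R \<epsilon> b by (force simp: R')
  have R'_sets: "R' \<in> sets M" using R'\<Omega> by (simp add: R'_def sets_restrict_space_iff)
  have "measure M R' = measure lebesgue R'" using R'\<Omega> by (simp add: measure_restrict_space)
  also have "\<dots> = \<epsilon> * b" unfolding R'_def using \<epsilon> b by (simp add: content_Pair)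
  finally have R'_measure: "measure M R' = \<epsilon> * b" .
  have "m * (\<epsilon> * b) / 16 = (\<integral>x. m / 16 * indicator R' x \<partial>M)"
    using R'_sets R'\<Omega> by (simp add: R'_measure Int_absorb2)
  also have "\<dots> \<le> (\<integral>x. \<psi> x * - fst (gh x) \<partial>M)"
  proof (rule integral_mono)
    have "emeasure M R' < \<infinity>" using emeasure_finite[of R'] by (simp only: infinity_ennreal_def less_top)
    then show "integrable M (\<lambda>x. m / 16 * indicator R' x)"
      using R'_sets by (intro integrable_mult_right integrable_real_indicator)
    show "integrable M (\<lambda>x. \<psi> x * - fst (gh x))" by (rule test_load(2)[OF test])
    fix x
    show "m / 16 * indicator R' x \<le> \<psi> x * - fst (gh x)"
    proof (cases "x \<in> C")
      case True
      then have "m \<le> - fst (gh x)" using bounds(3) C by auto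
      moreover have "1/16 * indicator R' x \<le> \<psi> x"
      proof (cases "x \<in> R'")
        case True
        then have "\<bar>X x\<bar> \<le> 1/2" "\<bar>Y x\<bar> \<le> 1/2" using \<epsilon> b by (auto simp: R' X_def Y_def abs_divide field_simps)
        then have "1/4 * (1/4) \<le> \<psi> x" unfolding \<psi>_def by (intro mult_mono bump_ge) (auto simp: bump_bounds)
        with True show ?thesis by simp
      qed (use \<psi>0 in auto)
      ultimately have "1/16 * indicator R' x * m \<le> \<psi> x * - fst (gh x)"
        using m \<psi>0[of x] by (intro mult_mono) auto
      then show ?thesis by (simp add: mult.commute)
    next
      case False
      then have "x \<notin> R'" using \<epsilon> b by (auto simp: C R')
      with out[OF False] show ?thesis by simp
    qed
  qed
  also have "\<dots> = (\<integral>x. h x * fst (d\<psi> x) \<partial>M)" by (rule test_load(1)[OF test, symmetric])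
  also have "\<dots> \<le> (\<integral>x. w \<beta> x * (dq x \<bullet> d\<psi> x) \<partial>M)"
    by (rule vi_supersolution[OF vi inK_test[OF test \<psi>0]])
  also have "\<dots> = (\<integral>x. q x * - D x \<partial>M)"
    using K by (intro H10_green[OF \<beta> _ test D1 c(2) D2 c(3) D_def D_l2]) (simp add: inK_def)
  also have "\<dots> \<le> (\<integral>x. \<Lambda> * q x \<partial>M)"
  proof (rule integral_mono_AE)
    show "integrable M (\<lambda>x. q x * - D x)" using l2_inner[OF lq D_l2] by simp
    show "AE x in M. q x * - D x \<le> \<Lambda> * q x"
      using q0
    proof eventually_elim
      case (elim x)
      have "q x * - D x \<le> q x * \<Lambda>" using D_le[of x] elim by (intro mult_left_mono) auto
      then show ?case by (simp add: mult.commute)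
    qed
  qed (use iq in simp)
  also have "\<dots> = \<Lambda> * (\<integral>x. q x \<partial>M)" by (rule integral_mult_right_zero)
  finally show ?thesis unfolding \<Lambda>_def .
qed

end

subsection \<open>Blow-up of the load at contact\<close>

lemma powr_neg_large:
  assumes "p > (0::real)"
  obtains \<delta> where "\<delta> > 0" "\<And>\<epsilon>. 0 < \<epsilon> \<Longrightarrow> \<epsilon> \<le> \<delta> \<Longrightarrow> N \<le> \<epsilon> powr (- p)"
proof
  \<comment> \<open>The maximum with 1 keeps the base of the power positive whatever the sign of
    \<open>N\<close>.\<close>
  define N' where "N' = max N 1"
  show "N' powr (- 1 / p) > 0" by (simp add: N'_def)
  fix \<epsilon> :: real assume "0 < \<epsilon>" "\<epsilon> \<le> N' powr (- 1 / p)"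
  then have "(N' powr (- 1 / p)) powr (- p) \<le> \<epsilon> powr (- p)"
    using assms by (intro powr_mono2') auto
  moreover have "(N' powr (- 1 / p)) powr (- p) = N'" using assms by (simp add: powr_powr N'_def)
  ultimately show "N \<le> \<epsilon> powr (- p)" by (simp add: N'_def)
qed

context film
begin

text \<open>\<open>s\<close> stands for |x_1| or for the Euclidean norm, so that both cases share
  one computation. The given gradient agrees with the one from the product rule because derivatives
  are unique.\<close>

lemma gradient_of_contact_profile:
  assumes \<alpha>: "\<alpha> \<ge> 1" and r: "ball 0 r \<subseteq> \<Omega>"
    and h: "\<And>x. x \<in> ball 0 r \<Longrightarrow> h x = s x powr \<alpha> * k x"
    and x: "x \<in> ball 0 r"
    and k: "(k has_derivative (\<lambda>v. gk \<bullet> v)) (at x)"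
    and s: "(s has_derivative (\<lambda>v. gs \<bullet> v)) (at x)" and "s x > 0"
  shows "gh x = (\<alpha> * s x powr (\<alpha> - 1) * k x) *\<^sub>R gs + (s x powr \<alpha>) *\<^sub>R gk" (is "_ = ?G")
proof -
  have "((\<lambda>z. z powr \<alpha>) has_field_derivative \<alpha> * s x powr (\<alpha> - 1)) (at (s x))"
    using \<open>s x > 0\<close> by (rule has_real_derivative_powr)
  from DERIV_compose_FDERIV[OF this s]
  have "((\<lambda>x. s x powr \<alpha> * k x) has_derivative
      (\<lambda>v. s x powr \<alpha> * (gk \<bullet> v) + ((gs \<bullet> v) * (\<alpha> * s x powr (\<alpha> - 1))) * k x)) (at x)"
    by (rule has_derivative_mult[OF _ k])
  then have "(h has_derivative (\<lambda>v. s x powr \<alpha> * (gk \<bullet> v) + ((gs \<bullet> v) * (\<alpha> * s x powr (\<alpha> - 1))) * k x)) (at x)"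
    by (rule has_derivative_transform_within_open[OF _ open_ball x]) (use h in simp)
  moreover have "(\<lambda>v. s x powr \<alpha> * (gk \<bullet> v) + ((gs \<bullet> v) * (\<alpha> * s x powr (\<alpha> - 1))) * k x) = (\<lambda>v. ?G \<bullet> v)"
    by (auto simp: fun_eq_iff inner_add_left)
  ultimately have "(h has_derivative (\<lambda>v. ?G \<bullet> v)) (at x)" by simp
  with h_deriv[of x] x r have "(\<lambda>v. gh x \<bullet> v) = (\<lambda>v. ?G \<bullet> v)"
    by (meson has_derivative_unique subsetD)
  then have "\<forall>v. gh x \<bullet> v = ?G \<bullet> v" by metis
  then show ?thesis using vector_eq_rdot by blast
qed

text \<open>Bounds $\epsilon^{2-3\alpha}$ times the factor in front of the load in
  \<open>load_lower_bound\<close>, where $A\epsilon^\alpha$ bounds the profile at scale $\epsilon$.\<close>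

definition rate_const :: "real \<Rightarrow> real \<Rightarrow> real" where
  "rate_const \<alpha> c = (let A = 4 powr \<alpha> * c in 36 * (A + 1)\<^sup>2 * ((\<alpha> + 1) * A) + 60 * (A + 1) ^ 3)"

text \<open>With $\beta = \epsilon^\alpha$ the film thickness, its gradient and the source $-\partial_1 h$ are of the
  orders $\epsilon^\alpha$, $\epsilon^{\alpha-1}$ and $\epsilon^{\alpha-1}$ on the rectangle. The height $b$ of the
  rectangle is fixed in the line contact case and $\epsilon$ in the point contact case, which gives the
  thresholds $1$ and $3/2$ for $\alpha$.\<close>

lemma load_near_contact:
  assumes \<alpha>: "\<alpha> \<ge> 1" and r: "ball 0 r \<subseteq> \<Omega>"
    and h: "\<And>x. x \<in> ball 0 r \<Longrightarrow> h x = s x powr \<alpha> * k x"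
    and k: "\<And>x. x \<in> ball 0 r \<Longrightarrow> (k has_derivative (\<lambda>v. gk x \<bullet> v)) (at x)"
    and c: "0 < c" "\<And>x. x \<in> ball 0 r \<Longrightarrow> c \<le> k x" "\<And>x. x \<in> ball 0 r \<Longrightarrow> k x \<le> C"
      "\<And>x. x \<in> ball 0 r \<Longrightarrow> norm (gk x) \<le> C"
    and \<epsilon>: "0 < \<epsilon>" "\<epsilon> \<le> b" "\<epsilon> \<le> 1" "32 * \<epsilon> * C \<le> c"
    and rect: "\<And>x. \<bar>fst x + 2 * \<epsilon>\<bar> \<le> \<epsilon> \<Longrightarrow> \<bar>snd x\<bar> \<le> b \<Longrightarrow> x \<in> ball 0 r"
    and s: "\<And>x. \<bar>fst x + 2 * \<epsilon>\<bar> \<le> \<epsilon> \<Longrightarrow> \<bar>snd x\<bar> \<le> b \<Longrightarrow>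
       \<epsilon> \<le> s x \<and> s x \<le> 4 * \<epsilon> \<and> (s has_derivative (\<lambda>v. gs x \<bullet> v)) (at x) \<and> norm (gs x) \<le> 1 \<and> 1/4 \<le> - fst (gs x)"
    and vi: "vi_solution \<Omega> h (\<epsilon> powr \<alpha>) 0 q dq"
  shows "c / (128 * rate_const \<alpha> C) * (\<epsilon> powr (2 - 2 * \<alpha>) * b) \<le> (\<integral>x. q x \<partial>M)"
proof -
  \<comment> \<open>On the rectangle \<open>s\<close> lies between \<epsilon> and 4 \<epsilon>,
    hence the power of 4. With \<open>e\<close> as unit the profile is of order
    \<open>e * \<epsilon>\<close> and its gradient of order \<open>e\<close>.\<close>
  define A where "A = 4 powr \<alpha> * C"
  define e where "e = \<epsilon> powr (\<alpha> - 1)"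
  have e: "e > 0" using \<epsilon> by (simp add: e_def)
  have \<epsilon>\<alpha>: "\<epsilon> powr \<alpha> = e * \<epsilon>" using \<epsilon> by (simp add: e_def powr_diff)
  have inR: "(- 2 * \<epsilon>, 0::real) \<in> ball 0 r" using \<epsilon> by (intro rect) auto
  have C: "C > 0" using c(1) c(2,3)[OF inR] by linarith
  have A: "A > 0" using C by (simp add: A_def)
  define B where "B = rate_const \<alpha> C"
  have B: "B = 36 * (A + 1)\<^sup>2 * ((\<alpha> + 1) * A) + 60 * (A + 1) ^ 3" by (simp add: B_def rate_const_def A_def Let_def)
  have Bpos: "B > 0" unfolding B using A \<alpha> by (intro add_pos_pos mult_pos_pos) auto
  have *: "h x \<le> A * (e * \<epsilon>) \<and> norm (gh x) \<le> (\<alpha> + 1) * A * e \<and> c / 8 * e \<le> - fst (gh x)"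
    if x: "\<bar>fst x + 2 * \<epsilon>\<bar> \<le> \<epsilon>" "\<bar>snd x\<bar> \<le> b" for x
  proof -
    note xr = rect[OF x]
    have sx: "\<epsilon> \<le> s x" "s x \<le> 4 * \<epsilon>" "(s has_derivative (\<lambda>v. gs x \<bullet> v)) (at x)" "norm (gs x) \<le> 1" "1/4 \<le> - fst (gs x)"
      using s[OF x] by auto
    have s0: "0 < s x" using sx \<epsilon> by linarith
    note kx = c(2,3,4)[OF xr]
    define t where "t = s x powr (\<alpha> - 1)"
    have st: "s x powr \<alpha> = t * s x" using s0 by (simp add: t_def powr_diff)
    have t: "e \<le> t" "t \<le> 4 powr (\<alpha> - 1) * e" "0 \<le> t"
      using sx \<epsilon> \<alpha> powr_mono2[of "\<alpha> - 1" \<epsilon> "s x"] powr_mono2[of "\<alpha> - 1" "s x" "4 * \<epsilon>"] s0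
      by (auto simp: t_def e_def powr_mult)
    have t4: "4 * t \<le> 4 powr \<alpha> * e" using t(2) by (simp add: powr_diff)
    have "t * s x * k x \<le> (4 powr (\<alpha> - 1) * e) * (4 * \<epsilon>) * C"
      using t sx s0 kx \<epsilon> c(1) e by (intro mult_mono) auto
    also have "\<dots> = A * (e * \<epsilon>)" by (simp add: A_def powr_diff)
    finally have 1: "h x \<le> A * (e * \<epsilon>)" using h[OF xr] st by simp
    have G: "gh x = (\<alpha> * t * k x) *\<^sub>R gs x + (t * s x) *\<^sub>R gk x"
      using gradient_of_contact_profile[OF \<alpha> r h xr k[OF xr] sx(3) s0] by (simp add: st t_def)
    have "norm (gh x) \<le> (\<alpha> * t * k x) * norm (gs x) + (t * s x) * norm (gk x)"
      unfolding G using norm_triangle_ineq[of "(\<alpha> * t * k x) *\<^sub>R gs x" "(t * s x) *\<^sub>R gk x"] \<alpha> t s0 kx c(1)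
      by (simp add: abs_mult)
    also have "\<dots> \<le> (\<alpha> * t * C) * 1 + (t * 4) * C"
      using \<alpha> t s0 kx c(1) sx \<epsilon> by (intro add_mono mult_mono) auto
    also have "\<dots> \<le> \<alpha> * (4 powr \<alpha> * e) * C + (4 powr \<alpha> * e) * C"
    proof -
      have "\<alpha> * t * C \<le> \<alpha> * (4 powr \<alpha> * e) * C"
        using t4 t(3) \<alpha> C by (intro mult_right_mono mult_left_mono) auto
      moreover have "(t * 4) * C \<le> (4 powr \<alpha> * e) * C"
        using t4 C by (intro mult_right_mono) auto
      ultimately show ?thesis by simp
    qed
    also have "\<dots> = (\<alpha> + 1) * A * e" by (simp add: A_def algebra_simps)
    finally have 2: "norm (gh x) \<le> (\<alpha> + 1) * A * e" .
    \<comment> \<open>The leading part of -d_1 h, coming from the power of \<open>s\<close>,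
      contributes at least c/4. The smallness of \<epsilon> lets the part with the derivative of
      \<open>k\<close> consume at most half of this.\<close>
    have "s x * C \<le> c / 8"
    proof -
      have "s x * C \<le> 4 * \<epsilon> * C" using sx C by (intro mult_right_mono) auto
      with \<epsilon>(4) show ?thesis by linarith
    qed
    moreover have "\<bar>fst (gk x)\<bar> \<le> C" using kx(3) norm_fst_le[of "fst (gk x)" "snd (gk x)"] by simp
    then have "s x * fst (gk x) \<le> s x * C" using s0 by (intro mult_left_mono) auto
    moreover have "1 * c * (1/4) \<le> \<alpha> * k x * - fst (gs x)"
      using \<alpha> kx c(1) sx by (intro mult_mono) auto
    ultimately have "c / 8 \<le> \<alpha> * k x * - fst (gs x) - s x * fst (gk x)" by linarith
    then have "e * (c / 8) \<le> t * (\<alpha> * k x * - fst (gs x) - s x * fst (gk x))"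
      using t c(1) by (intro mult_mono) auto
    also have "\<dots> = - fst (gh x)" by (simp add: G algebra_simps)
    finally have 3: "c / 8 * e \<le> - fst (gh x)" by (simp add: mult.commute)
    from 1 2 3 show ?thesis by blast
  qed
  have "c / 8 * e * (\<epsilon> * b) / 16 \<le> (36 * ((A + 1) * (e * \<epsilon>))\<^sup>2 * ((\<alpha> + 1) * A * e) / \<epsilon>
      + 60 * ((A + 1) * (e * \<epsilon>)) ^ 3 / \<epsilon>\<^sup>2) * (\<integral>x. q x \<partial>M)"
  proof (rule load_lower_bound[OF _ vi \<epsilon>(1,2), where a = "- 2 * \<epsilon>"])
    fix x assume x: "\<bar>fst x - - 2 * \<epsilon>\<bar> \<le> \<epsilon>" "\<bar>snd x\<bar> \<le> b"
    then have x': "\<bar>fst x + 2 * \<epsilon>\<bar> \<le> \<epsilon>" by simp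
    show "x \<in> \<Omega>" using rect[OF x' x(2)] r by blast
    show "h x + \<epsilon> powr \<alpha> \<le> (A + 1) * (e * \<epsilon>)" "norm (gh x) \<le> (\<alpha> + 1) * A * e" "c / 8 * e \<le> - fst (gh x)"
      using *[OF x' x(2)] by (auto simp: \<epsilon>\<alpha> algebra_simps)
  qed (use \<epsilon> e c(1) in auto)
  \<comment> \<open>Both terms scale alike: (e \<epsilon>)^2 e / \<epsilon> and (e \<epsilon>)^3 /
    \<epsilon>^2 are each e^3 \<epsilon>.\<close>
  also have "36 * ((A + 1) * (e * \<epsilon>))\<^sup>2 * ((\<alpha> + 1) * A * e) / \<epsilon> + 60 * ((A + 1) * (e * \<epsilon>)) ^ 3 / \<epsilon>\<^sup>2 = B * e ^ 3 * \<epsilon>"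
  proof -
    define P Q where "P = A + 1" and "Q = (\<alpha> + 1) * A"
    have "36 * (P * (e * \<epsilon>))\<^sup>2 * (Q * e) / \<epsilon> + 60 * (P * (e * \<epsilon>)) ^ 3 / \<epsilon>\<^sup>2
        = (36 * P\<^sup>2 * Q + 60 * P ^ 3) * e ^ 3 * \<epsilon>"
      using \<epsilon>(1) by (simp add: power_mult_distrib power2_eq_square power3_eq_cube distrib_right)
    then show ?thesis by (simp only: P_def Q_def B)
  qed
  \<comment> \<open>128 = 8 * 16: the 8 from the lower bound on -d_1 h, the 16 from the bump. After
    the common factor cancels, the load is compared with 1/e^2, which is the power in the
    conclusion.\<close>
  finally have "(e * \<epsilon>) * (c / 128 * b) \<le> (e * \<epsilon>) * (B * e\<^sup>2 * (\<integral>x. q x \<partial>M))"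
    by (simp add: power2_eq_square power3_eq_cube mult_ac)
  then have low: "c / 128 * b \<le> B * e\<^sup>2 * (\<integral>x. q x \<partial>M)"
    using e \<epsilon>(1) by (subst (asm) mult_le_cancel_left_pos) auto
  have "c / (128 * B) * (1 / e\<^sup>2 * b) = (c / 128 * b) / (B * e\<^sup>2)" by simp
  also have "\<dots> \<le> (\<integral>x. q x \<partial>M)" using low Bpos e by (subst pos_divide_le_eq) (auto simp: mult.commute)
  finally have "c / (128 * B) * (1 / e\<^sup>2 * b) \<le> (\<integral>x. q x \<partial>M)" .
  moreover have "1 / e\<^sup>2 = \<epsilon> powr (2 - 2 * \<alpha>)"
  proof -
    have "e\<^sup>2 = \<epsilon> powr (2 * \<alpha> - 2)"
      unfolding e_def power2_eq_square powr_add[symmetric] by (simp add: algebra_simps)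
    then show ?thesis using powr_minus_divide[of \<epsilon> "2 * \<alpha> - 2"] by simp
  qed
  ultimately show ?thesis by (simp add: B_def)
qed

lemma local_profile_bounds:
  assumes W: "open W" "(0::pt) \<in> W" and k: "C1_closure W k" "\<And>x. x \<in> closure W \<Longrightarrow> k x > 0"
  obtains r gk c C where "r > 0" "ball 0 r \<subseteq> W" "c > 0" "C > 0"
    "\<And>x. x \<in> ball 0 r \<Longrightarrow> (k has_derivative (\<lambda>v. gk x \<bullet> v)) (at x)"
    "\<And>x. x \<in> ball 0 r \<Longrightarrow> c \<le> k x" "\<And>x. x \<in> ball 0 r \<Longrightarrow> k x \<le> C"
    "\<And>x. x \<in> ball 0 r \<Longrightarrow> norm (gk x) \<le> C"
proof -
  from k(1) obtain gk where kc: "continuous_on (closure W) k" and gk: "continuous_on (closure W) gk"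
    "\<And>x. x \<in> W \<Longrightarrow> (k has_derivative (\<lambda>v. gk x \<bullet> v)) (at x)"
    unfolding C1_closure_def by blast
  have "continuous_on W k" "continuous_on W gk"
    using kc gk(1) closure_subset by (auto intro: continuous_on_subset)
  then have lim: "(k \<longlongrightarrow> k 0) (at 0)" "(gk \<longlongrightarrow> gk 0) (at 0)"
    using W by (auto simp: continuous_on_eq_continuous_at isCont_def)
  have k0: "k 0 > 0" using k(2) W closure_subset by blast
  \<comment> \<open>Strictly above both \<open>k 0\<close> and \<open>norm (gk 0)\<close>, so a
    single constant bounds the factor and its gradient near 0.\<close>
  define C where "C = 2 * k 0 + norm (gk 0) + 1"
  have C: "C > k 0" "C > norm (gk 0)" "C > 0" using k0 by (auto simp: C_def add_pos_nonneg)
  have "\<forall>\<^sub>F x in at 0. k 0 / 2 < k x \<and> k x < C \<and> norm (gk x) < C"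
    using k0 C by (intro eventually_conj order_tendstoD(1)[OF lim(1)] order_tendstoD(2)[OF lim(1)]
        order_tendstoD(2)[OF tendsto_norm[OF lim(2)]]) auto
  moreover have "\<forall>\<^sub>F x in at 0. x \<in> W" using W by (rule eventually_at_in_open')
  ultimately have "\<forall>\<^sub>F x in at 0. x \<in> W \<and> k 0 / 2 < k x \<and> k x < C \<and> norm (gk x) < C"
    by eventually_elim auto
  then obtain r where r: "r > 0" "\<And>x. x \<noteq> 0 \<Longrightarrow> dist x 0 < r \<Longrightarrow> x \<in> W \<and> k 0 / 2 < k x \<and> k x < C \<and> norm (gk x) < C"
    unfolding eventually_at by auto
  have *: "x \<in> W \<and> k 0 / 2 < k x \<and> k x < C \<and> norm (gk x) < C" if "x \<in> ball 0 r" for x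
  proof (cases "x = 0")
    case True
    then show ?thesis using W C k0 by auto
  next
    case False
    then show ?thesis using r(2)[of x] that by (simp add: dist_commute)
  qed
  show thesis
  proof (rule that[of r "k 0 / 2" C gk])
    show "ball 0 r \<subseteq> W" using * by blast
    fix x :: pt assume "x \<in> ball 0 r"
    from *[OF this] gk(2)[of x] show "(k has_derivative (\<lambda>v. gk x \<bullet> v)) (at x)"
      "k 0 / 2 \<le> k x" "k x \<le> C" "norm (gk x) \<le> C" by auto
  qed (use r k0 C in auto)
qed

lemma load_unbounded:
  assumes "(\<exists>\<alpha>. case_I \<Omega> h \<alpha> \<and> \<alpha> > 1) \<or> (\<exists>\<alpha>. case_II \<Omega> h \<alpha> \<and> \<alpha> > 3/2)"
  shows "\<exists>\<beta>>0. \<forall>q dq. vi_solution \<Omega> h \<beta> 0 q dq \<longrightarrow> N \<le> (\<integral>x. q x \<partial>M)"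
proof -
  have norm_pt: "norm x \<le> \<bar>fst x\<bar> + \<bar>snd x\<bar>" "\<bar>fst x\<bar> \<le> norm x" for x :: pt
    using norm_Pair_le[of "fst x" "snd x"] norm_fst_le[of "fst x" "snd x"] by auto
  show ?thesis
    using assms
  proof (elim disjE exE conjE)
    fix \<alpha> assume I: "case_I \<Omega> h \<alpha>" and \<alpha>: "\<alpha> > 1"
    obtain W k where W: "open W" "(0::pt) \<in> W" "W \<subseteq> \<Omega>" "C1_closure W k" "\<And>x. x \<in> closure W \<Longrightarrow> k x > 0"
      "\<And>x. x \<in> W \<Longrightarrow> h x = \<bar>fst x\<bar> powr \<alpha> * k x"
      using I unfolding case_I_def by blast
    obtain r gk c C where r: "r > 0" "ball 0 r \<subseteq> W" and c: "c > 0" "C > 0"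
      and k: "\<And>x. x \<in> ball 0 r \<Longrightarrow> (k has_derivative (\<lambda>v. gk x \<bullet> v)) (at x)"
        "\<And>x. x \<in> ball 0 r \<Longrightarrow> c \<le> k x" "\<And>x. x \<in> ball 0 r \<Longrightarrow> k x \<le> C"
        "\<And>x. x \<in> ball 0 r \<Longrightarrow> norm (gk x) \<le> C"
      by (rule local_profile_bounds[OF W(1,2,4,5)]) blast+
    define K where "K = c / (128 * rate_const \<alpha> C)"
    have K: "K > 0"
      unfolding K_def rate_const_def Let_def using c \<alpha> by (intro divide_pos_pos mult_pos_pos add_pos_pos zero_less_power) auto
    obtain \<delta> where \<delta>: "\<delta> > 0" "\<And>\<epsilon>. 0 < \<epsilon> \<Longrightarrow> \<epsilon> \<le> \<delta> \<Longrightarrow> N / (K * (r / 2)) \<le> \<epsilon> powr (- (2 * \<alpha> - 2))"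
      by (rule powr_neg_large[of "2 * \<alpha> - 2"]) (use \<alpha> in auto)
    \<comment> \<open>\<delta> brings the load above \<open>N\<close>; r/8 keeps the rectangle in
      the ball, as 3 \<epsilon> + r/2 < r; the last entry makes the derivative of \<open>k\<close>
      negligible.\<close>
    define \<epsilon> where "\<epsilon> = Min {\<delta>, r / 8, 1, c / (32 * C)}"
    have \<epsilon>: "0 < \<epsilon>" "\<epsilon> \<le> \<delta>" "\<epsilon> \<le> r / 8" "\<epsilon> \<le> 1" "\<epsilon> \<le> c / (32 * C)"
      using \<delta> r c by (auto simp: \<epsilon>_def)
    have \<epsilon>C: "32 * \<epsilon> * C \<le> c" using \<epsilon>(5) c by (simp add: field_simps)
    show ?thesis
    proof (intro exI[of _ "\<epsilon> powr \<alpha>"] conjI allI impI)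
      fix q dq assume vi: "vi_solution \<Omega> h (\<epsilon> powr \<alpha>) 0 q dq"
      have "K * (\<epsilon> powr (2 - 2 * \<alpha>) * (r / 2)) \<le> (\<integral>x. q x \<partial>M)"
        unfolding K_def
      proof (rule load_near_contact[OF _ _ _ k(1) c(1) k(2-4) \<epsilon>(1) _ \<epsilon>(4) \<epsilon>C _ _ vi,
            where s="\<lambda>x. \<bar>fst x\<bar>" and gs="\<lambda>x. (-1, 0)"])
        fix x :: pt assume x: "\<bar>fst x + 2 * \<epsilon>\<bar> \<le> \<epsilon>" "\<bar>snd x\<bar> \<le> r / 2"
        then have fx: "fst x \<le> - \<epsilon>" "\<bar>fst x\<bar> \<le> 3 * \<epsilon>" using \<epsilon>(1) by (auto simp: abs_le_iff)
        then have "norm x < r" using norm_pt(1)[of x] x(2) \<epsilon>(3) r(1) by linarith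
        then show "x \<in> ball 0 r" by simp
        have "((\<lambda>x. - fst x) has_derivative (\<lambda>v. (-1, 0) \<bullet> v)) (at x)"
          by (auto intro!: derivative_eq_intros simp: inner_prod_def)
        then have "((\<lambda>x. \<bar>fst x\<bar>) has_derivative (\<lambda>v. (-1, 0) \<bullet> v)) (at x)"
        proof (rule has_derivative_transform_within_open)
          show "open {x :: pt. fst x < 0}" by (intro open_Collect_less continuous_intros)
        qed (use fx \<epsilon>(1) in auto)
        then show "\<epsilon> \<le> \<bar>fst x\<bar> \<and> \<bar>fst x\<bar> \<le> 4 * \<epsilon> \<and> ((\<lambda>x. \<bar>fst x\<bar>) has_derivative (\<lambda>v. (-1, 0) \<bullet> v)) (at x) \<and>
            norm (-1::real, 0::real) \<le> 1 \<and> 1/4 \<le> - fst (-1::real, 0::real)"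
          using fx \<epsilon>(1) by (simp add: norm_Pair)
      qed (use \<alpha> r W \<epsilon> in auto)
      moreover have "N / (K * (r / 2)) \<le> \<epsilon> powr (2 - 2 * \<alpha>)" using \<delta>(2)[OF \<epsilon>(1,2)] by simp
      then have "N \<le> K * (\<epsilon> powr (2 - 2 * \<alpha>) * (r / 2))" using K r by (simp add: field_simps)
      ultimately show "N \<le> (\<integral>x. q x \<partial>M)" by linarith
    qed (use \<epsilon> in simp)
  next
    fix \<alpha> assume II: "case_II \<Omega> h \<alpha>" and \<alpha>: "\<alpha> > 3/2"
    obtain W k where W: "open W" "(0::pt) \<in> W" "W \<subseteq> \<Omega>" "C1_closure W k" "\<And>x. x \<in> closure W \<Longrightarrow> k x > 0"
      "\<And>x. x \<in> W \<Longrightarrow> h x = norm x powr \<alpha> * k x"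
      using II unfolding case_II_def by blast
    obtain r gk c C where r: "r > 0" "ball 0 r \<subseteq> W" and c: "c > 0" "C > 0"
      and k: "\<And>x. x \<in> ball 0 r \<Longrightarrow> (k has_derivative (\<lambda>v. gk x \<bullet> v)) (at x)"
        "\<And>x. x \<in> ball 0 r \<Longrightarrow> c \<le> k x" "\<And>x. x \<in> ball 0 r \<Longrightarrow> k x \<le> C"
        "\<And>x. x \<in> ball 0 r \<Longrightarrow> norm (gk x) \<le> C"
      by (rule local_profile_bounds[OF W(1,2,4,5)]) blast+
    define K where "K = c / (128 * rate_const \<alpha> C)"
    have K: "K > 0"
      unfolding K_def rate_const_def Let_def using c \<alpha> by (intro divide_pos_pos mult_pos_pos add_pos_pos zero_less_power) auto
    obtain \<delta> where \<delta>: "\<delta> > 0" "\<And>\<epsilon>. 0 < \<epsilon> \<Longrightarrow> \<epsilon> \<le> \<delta> \<Longrightarrow> N / K \<le> \<epsilon> powr (- (2 * \<alpha> - 3))"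
      by (rule powr_neg_large[of "2 * \<alpha> - 3"]) (use \<alpha> in auto)
    define \<epsilon> where "\<epsilon> = Min {\<delta>, r / 8, 1, c / (32 * C)}"
    have \<epsilon>: "0 < \<epsilon>" "\<epsilon> \<le> \<delta>" "\<epsilon> \<le> r / 8" "\<epsilon> \<le> 1" "\<epsilon> \<le> c / (32 * C)"
      using \<delta> r c by (auto simp: \<epsilon>_def)
    have \<epsilon>C: "32 * \<epsilon> * C \<le> c" using \<epsilon>(5) c by (simp add: field_simps)
    show ?thesis
    proof (intro exI[of _ "\<epsilon> powr \<alpha>"] conjI allI impI)
      fix q dq assume vi: "vi_solution \<Omega> h (\<epsilon> powr \<alpha>) 0 q dq"
      have "K * (\<epsilon> powr (2 - 2 * \<alpha>) * \<epsilon>) \<le> (\<integral>x. q x \<partial>M)"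
        unfolding K_def
      proof (rule load_near_contact[OF _ _ _ k(1) c(1) k(2-4) \<epsilon>(1) _ \<epsilon>(4) \<epsilon>C _ _ vi,
            where s=norm and gs=sgn])
        fix x :: pt assume x: "\<bar>fst x + 2 * \<epsilon>\<bar> \<le> \<epsilon>" "\<bar>snd x\<bar> \<le> \<epsilon>"
        then have fx: "fst x \<le> - \<epsilon>" "\<bar>fst x\<bar> \<le> 3 * \<epsilon>" using \<epsilon>(1) by (auto simp: abs_le_iff)
        have n: "\<epsilon> \<le> norm x" "norm x \<le> 4 * \<epsilon>" using norm_pt[of x] fx x(2) by linarith+
        then show "x \<in> ball 0 r" using \<epsilon>(3) r(1) by simp
        have x0: "x \<noteq> 0" using n \<epsilon>(1) by auto
        have "(norm has_derivative (\<lambda>v. sgn x \<bullet> v)) (at x)"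
          using has_derivative_norm[OF x0] by (simp add: inner_commute)
        \<comment> \<open>On the square the direction of \<open>x\<close> stays away from the
          x_2-axis: -x_1 is at least \<epsilon> while the norm is at most 4 \<epsilon>. This is the
          origin of the 1/4 in \<open>load_near_contact\<close>.\<close>
        moreover have "norm x \<le> - fst x * 4" using n fx by linarith
        then have "1/4 \<le> - fst (sgn x)" using x0 by (simp add: sgn_div_norm field_simps)
        ultimately show "\<epsilon> \<le> norm x \<and> norm x \<le> 4 * \<epsilon> \<and> (norm has_derivative (\<lambda>v. sgn x \<bullet> v)) (at x) \<and>
            norm (sgn x) \<le> 1 \<and> 1/4 \<le> - fst (sgn x)"
          using n x0 by (simp add: norm_sgn)
      qed (use \<alpha> r W \<epsilon> in auto)
      \<comment> \<open>The height \<epsilon> of the square costs one power compared with line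
        contact; the exponent 3 - 2 \<alpha> is negative exactly for \<alpha> > 3/2.\<close>
      moreover have "\<epsilon> powr (2 - 2 * \<alpha>) * \<epsilon> = \<epsilon> powr (- (2 * \<alpha> - 3))"
        using \<epsilon>(1) powr_add[of \<epsilon> "2 - 2 * \<alpha>" 1] by simp
      moreover have "N \<le> K * \<epsilon> powr (- (2 * \<alpha> - 3))" using \<delta>(2)[OF \<epsilon>(1,2)] K by (simp add: field_simps)
      ultimately show "N \<le> (\<integral>x. q x \<partial>M)" by simp
    qed (use \<epsilon> in simp)
  qed
qed

section \<open>The value of G and the intermediate value argument\<close>

lemma G_fun_eq:
  assumes \<beta>: "\<beta> > 0" and vi: "vi_solution \<Omega> h \<beta> 0 q dq"
  shows "G_fun \<Omega> h F \<beta> 0 = (\<integral>x. q x \<partial>M) - F"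
proof -
  obtain C where "C \<ge> 0" "\<And>\<beta> q dq. 0 < \<beta> \<Longrightarrow> vi_solution \<Omega> h \<beta> 0 q dq \<Longrightarrow> \<bar>\<integral>x. q x \<partial>M\<bar> \<le> C / \<beta> ^ 3"
    and C: "\<And>\<beta> \<beta>' B q q' dq dq'. 0 < \<beta> \<Longrightarrow> \<beta> \<le> B \<Longrightarrow> 0 < \<beta>' \<Longrightarrow> \<beta>' \<le> B \<Longrightarrow> vi_solution \<Omega> h \<beta> 0 q dq \<Longrightarrow>
       vi_solution \<Omega> h \<beta>' 0 q' dq' \<Longrightarrow>
       \<bar>(\<integral>x. q x \<partial>M) - (\<integral>x. q' x \<partial>M)\<bar> \<le> C * (H + B)\<^sup>2 * \<bar>\<beta> - \<beta>'\<bar> / (\<beta> ^ 3 * \<beta>' ^ 3)"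
    by (fact load_estimates)
  \<comment> \<open>The definite description ranges over loads, so it is enough that two solutions
    have equal integrals; the stability estimate with \<beta>' = \<beta> says this.\<close>
  have unique: "(\<integral>x. q' x \<partial>M) = (\<integral>x. q x \<partial>M)" if "vi_solution \<Omega> h \<beta> 0 q' dq'" for q' dq'
    using C[OF \<beta> order_refl \<beta> order_refl that vi] by simp
  have "(THE I. \<exists>q dq. vi_solution \<Omega> h \<beta> 0 q dq \<and> I = (\<integral>x. q x \<partial>M)) = (\<integral>x. q x \<partial>M)"
  proof (rule the_equality)
    show "\<exists>q' dq'. vi_solution \<Omega> h \<beta> 0 q' dq' \<and> (\<integral>x. q x \<partial>M) = (\<integral>x. q' x \<partial>M)"
      using vi by blast
  qed (use unique in metis)
  then show ?thesis unfolding G_fun_def set_integral_M by (rule arg_cong)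
qed

lemma G_fun_zero:
  assumes F: "F > 0" 
    and unbounded: "\<exists>\<beta>>0. \<forall>q dq. vi_solution \<Omega> h \<beta> 0 q dq \<longrightarrow> F \<le> (\<integral>x. q x \<partial>M)"
  shows "\<exists>\<eta>>0. G_fun \<Omega> h F \<eta> 0 = 0"
proof -
  obtain C where C: "C \<ge> 0" "\<And>\<beta> q dq. 0 < \<beta> \<Longrightarrow> vi_solution \<Omega> h \<beta> 0 q dq \<Longrightarrow> \<bar>\<integral>x. q x \<partial>M\<bar> \<le> C / \<beta> ^ 3"
    "\<And>\<beta> \<beta>' B q q' dq dq'. 0 < \<beta> \<Longrightarrow> \<beta> \<le> B \<Longrightarrow> 0 < \<beta>' \<Longrightarrow> \<beta>' \<le> B \<Longrightarrow> vi_solution \<Omega> h \<beta> 0 q dq \<Longrightarrow>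
       vi_solution \<Omega> h \<beta>' 0 q' dq' \<Longrightarrow>
       \<bar>(\<integral>x. q x \<partial>M) - (\<integral>x. q' x \<partial>M)\<bar> \<le> C * (H + B)\<^sup>2 * \<bar>\<beta> - \<beta>'\<bar> / (\<beta> ^ 3 * \<beta>' ^ 3)"
    by (fact load_estimates)
  obtain a where a: "a > 0" "\<And>q dq. vi_solution \<Omega> h a 0 q dq \<Longrightarrow> F \<le> (\<integral>x. q x \<partial>M)"
    using unbounded by blast
  \<comment> \<open>One solution is chosen for every \<beta>; by \<open>G_fun_eq\<close> the
    resulting function \<open>Q\<close> represents G irrespective of the choice.\<close>
  have "\<forall>\<beta>. \<exists>p. \<beta> > 0 \<longrightarrow> vi_solution \<Omega> h \<beta> 0 (fst p) (snd p)"
    using vi_solution_exists by fastforce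
  from choice[OF this] obtain p where p: "\<And>\<beta>. \<beta> > 0 \<Longrightarrow> vi_solution \<Omega> h \<beta> 0 (fst (p \<beta>)) (snd (p \<beta>))"
    by blast
  define Q where "Q \<beta> = (\<integral>x. fst (p \<beta>) x \<partial>M)" for \<beta>
  have GQ: "G_fun \<Omega> h F \<beta> 0 = Q \<beta> - F" if "\<beta> > 0" for \<beta>
    using G_fun_eq[OF that p[OF that]] by (simp add: Q_def)
  \<comment> \<open>b \<ge> 1 gives b^3 \<ge> b \<ge> C/F, which puts the load at \<open>b\<close>
    below F; b \<ge> a orders the interval.\<close>
  define b where "b = max a (max 1 (C / F))"
  have b: "a \<le> b" "1 \<le> b" "C / F \<le> b" by (auto simp: b_def)
  have "Q b \<le> F"
  proof -
    have "C / F \<le> b ^ 3" using b power_increasing[of 1 3 b] by simp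
    then have "C / b ^ 3 \<le> F" using F b by (simp add: field_simps)
    moreover have "\<bar>Q b\<bar> \<le> C / b ^ 3" unfolding Q_def by (rule C(2)[OF _ p]) (use a b in auto)
    ultimately show ?thesis by linarith
  qed
  moreover have "F \<le> Q a" unfolding Q_def by (rule a(2)[OF p[OF a(1)]])
  moreover have "continuous_on {a..b} Q"
  proof (rule lipschitz_on_continuous_on)
    define L where "L = C * (H + b)\<^sup>2 / (a ^ 3 * a ^ 3)"
    show "L-lipschitz_on {a..b} Q"
    proof (rule lipschitz_onI)
      show "0 \<le> L" using C(1) a by (simp add: L_def)
      fix x y assume xy: "x \<in> {a..b}" "y \<in> {a..b}"
      then have pos: "0 < x" "0 < y" using a by auto
      have "\<bar>Q x - Q y\<bar> \<le> C * (H + b)\<^sup>2 * \<bar>x - y\<bar> / (x ^ 3 * y ^ 3)"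
        unfolding Q_def using xy by (intro C(3)[OF pos(1) _ pos(2) _ p[OF pos(1)] p[OF pos(2)]]) auto
      \<comment> \<open>Staying to the right of \<open>a\<close> bounds both denominators below, so
        the local estimate becomes a single Lipschitz constant.\<close>
      also have "\<dots> \<le> C * (H + b)\<^sup>2 * \<bar>x - y\<bar> / (a ^ 3 * a ^ 3)"
        using xy a C(1) by (intro divide_left_mono mult_mono power_mono mult_nonneg_nonneg mult_pos_pos zero_less_power) auto
      finally show "dist (Q x) (Q y) \<le> L * dist x y" by (simp add: L_def dist_real_def)
    qed
  qed
  ultimately obtain \<eta> where "a \<le> \<eta>" "Q \<eta> = F"
    using IVT2'[of Q b F a] b by auto
  then show ?thesis using GQ[of \<eta>] a by (intro exI[of _ \<eta>]) auto
qed

end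

theorem theorem2p2:
  fixes \<Omega> :: "(real \<times> real) set" and h0 :: "real \<times> real \<Rightarrow> real" and F :: real
  assumes "standing \<Omega> h0"
    and "F > 0"
    and "(\<exists>\<alpha>. case_I \<Omega> h0 \<alpha> \<and> \<alpha> > 1) \<or> (\<exists>\<alpha>. case_II \<Omega> h0 \<alpha> \<and> \<alpha> > 3/2)"
  shows "\<exists>\<eta>>0. G_fun \<Omega> h0 F \<eta> 0 = 0"
proof -
  have st: "bounded \<Omega>" "open \<Omega>" "C1_closure \<Omega> h0" "\<And>x. x \<in> closure \<Omega> \<Longrightarrow> h0 x \<ge> 0"
    using assms(1) by (auto simp: standing_def)
  from st(3) obtain g where g: "continuous_on (closure \<Omega>) h0" "continuous_on (closure \<Omega>) g"
    "\<And>x. x \<in> \<Omega> \<Longrightarrow> (h0 has_derivative (\<lambda>v. g x \<bullet> v)) (at x)"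
    unfolding C1_closure_def by blast
  have "compact (h0 ` closure \<Omega>)"
    using st(1) g(1) by (intro compact_continuous_image) auto
  then obtain B where B: "\<And>x. x \<in> closure \<Omega> \<Longrightarrow> \<bar>h0 x\<bar> \<le> B"
    by (metis bounded_iff compact_imp_bounded image_eqI real_norm_def)
  \<comment> \<open>The maximum with 1 supplies the positive upper bound that the locale
    requires.\<close>
  interpret film \<Omega> h0 g "max B 1"
  proof
    fix x assume "x \<in> \<Omega>"
    then have "x \<in> closure \<Omega>" using closure_subset by blast
    then show "0 \<le> h0 x" "h0 x \<le> max B 1" using st(4) B[of x] by auto
  next
    show "continuous_on \<Omega> g" using g(2) closure_subset by (rule continuous_on_subset)
  qed (use st g in auto)
  show ?thesis by (rule G_fun_zero[OF assms(2) load_unbounded[OF assms(3)]])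
qed

end
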